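(* For all positive integers $r$ and $k$, if a graph $G$ does not contain $k$ vertex-disjoint copies of $K_{2,r}$ as minors, then $\mathbf{tw}(G) < 20k^2r^2 - 8k^2r + 2r - 1$.
   Context: Graphs are finite, simple, undirected. $\mathbf{tw}(G)$ denotes the treewidth of $G$. $K_{2,r}$ is the complete bipartite graph with parts of sizes $2$ and $r$. "$G$ contains $k$ disjoint copies of $K_{2,r}$ as minors" means $G$ contains the disjoint union of $k$ copies of $K_{2,r}$ as a minor. *)

theory Defs
  imports "Graph_Theory.Kuratowski" "HOL-Library.Disjoint_Sets"
begin

text \<open>
  A finite simple undirected graph is a \<^const>\<open>pair_graph\<close>: a finite vertex set with an
  irreflexive symmetric arc relation, every edge being present as two opposite arcs.
\<close>

definition complete_bipartite :: "nat \<Rightarrow> nat \<Rightarrow> (nat + nat) pair_pre_digraph" where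
  "complete_bipartite m n = (let A = Inl ` {..<m}; B = Inr ` {..<n}
     in \<lparr> pverts = A \<union> B, parcs = A \<times> B \<union> B \<times> A \<rparr>)"

definition disjoint_copies :: "nat \<Rightarrow> 'a pair_pre_digraph \<Rightarrow> (nat \<times> 'a) pair_pre_digraph" where
  "disjoint_copies k H = \<lparr> pverts = {..<k} \<times> pverts H,
     parcs = {((i, x), (i, y)) | i x y. i < k \<and> (x, y) \<in> parcs H} \<rparr>"

text \<open>
  Minors are given by branch sets. Library connectedness requires a nonempty vertex set, so
  every branch set is nonempty.
\<close>

definition minor_of :: "'b pair_pre_digraph \<Rightarrow> 'a pair_pre_digraph \<Rightarrow> bool" where
  "minor_of H G \<longleftrightarrow> (\<exists>B.
     (\<forall>x \<in> pverts H. B x \<subseteq> pverts G \<and> Digraph_Component.connected (with_proj G \<restriction> B x)) \<and>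
     disjoint_family_on B (pverts H) \<and>
     (\<forall>(x, y) \<in> parcs H. \<exists>u \<in> B x. \<exists>v \<in> B y. (u, v) \<in> parcs G))"

text \<open>
  The library constant \<^const>\<open>tree\<close> is not usable for undirected graphs: a single
  edge, seen as two opposite arcs, is a directed cycle of length 2 for it. A directed cycle of
  length at least 3 in a \<^const>\<open>pair_graph\<close> is exactly a cycle of the undirected graph.
\<close>

definition undirected_tree :: "'a pair_pre_digraph \<Rightarrow> bool" where
  "undirected_tree T \<longleftrightarrow> pair_graph T \<and> Digraph_Component.connected (with_proj T) \<and>
     \<not> (\<exists>p. pre_digraph.cycle (with_proj T) p \<and> length p \<ge> 3)"

definition tree_decomposition ::
    "'a pair_pre_digraph \<Rightarrow> 't pair_pre_digraph \<Rightarrow> ('t \<Rightarrow> 'a set) \<Rightarrow> bool" where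
  "tree_decomposition G T bag \<longleftrightarrow>
     undirected_tree T \<and>
     (\<Union>t \<in> pverts T. bag t) = pverts G \<and>
     (\<forall>(u, v) \<in> parcs G. \<exists>t \<in> pverts T. u \<in> bag t \<and> v \<in> bag t) \<and>
     (\<forall>v \<in> pverts G. Digraph_Component.connected (with_proj T \<restriction> {t \<in> pverts T. v \<in> bag t}))"

text \<open>Integer-valued, so that the graph without vertices has treewidth \<open>-1\<close>.\<close>

definition decomposition_width :: "'t pair_pre_digraph \<Rightarrow> ('t \<Rightarrow> 'a set) \<Rightarrow> int" where
  "decomposition_width T bag = int (Max ((\<lambda>t. card (bag t)) ` pverts T)) - 1"

text \<open>
  Trees are finite, so restricting the nodes to natural numbers loses no decomposition up to
  renaming of nodes.
\<close>

definition treewidth :: "'a pair_pre_digraph \<Rightarrow> int" where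
  "treewidth G = (LEAST w. \<exists>(T :: nat pair_pre_digraph) bag.
     tree_decomposition G T bag \<and> w = decomposition_width T bag)"


lemma complete_bipartite_library: "K\<^bsub>m,n\<^esub> (with_proj (complete_bipartite m n))"
proof -
  let ?A = "Inl ` {..<m} :: (nat + nat) set" and ?B = "Inr ` {..<n} :: (nat + nat) set"
  have "?A \<inter> ?B = {}" "card ?A = m" "card ?B = n"
    by (auto simp: card_image)
  then show ?thesis
    unfolding complete_bipartite_digraph_pair_def complete_bipartite_def Let_def
    by (intro conjI exI[of _ ?A] exI[of _ ?B]) simp_all
qed

lemma pair_graph_complete_bipartite: "pair_graph (complete_bipartite m n)"
  using complete_bipartite_library by (rule pair_graphI_complete_bipartite)

lemma pair_graph_disjoint_copies:
  assumes "pair_graph H"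
  shows "pair_graph (disjoint_copies k H)"
proof -
  interpret H: pair_graph H by fact
  have fin: "finite ({..<k} \<times> pverts H)" using H.pair_finite_verts by simp
  have sub: "parcs (disjoint_copies k H) \<subseteq> ({..<k} \<times> pverts H) \<times> ({..<k} \<times> pverts H)"
    by (auto simp: disjoint_copies_def dest: H.in_arcsD1 H.in_arcsD2)
  show ?thesis
  proof
    show "finite (parcs (disjoint_copies k H))"
      using sub fin by (meson finite_SigmaI finite_subset)
    show "symmetric (with_proj (disjoint_copies k H))"
      by (auto simp: symmetric_def disjoint_copies_def intro!: symI dest: H.arcs_symmetric)
  qed (use fin sub H.no_loops' in \<open>auto simp: disjoint_copies_def dest: H.in_arcsD1 H.in_arcsD2\<close>)
qed

lemma tree_decomposition_exists:
  assumes "pair_graph G"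
  shows "\<exists>(T :: nat pair_pre_digraph) bag. tree_decomposition G T bag"
proof -
  interpret G: pair_graph G by fact
  let ?T = "\<lparr> pverts = {0}, parcs = {} \<rparr> :: nat pair_pre_digraph"
  have T: "pair_graph ?T"
    by unfold_locales (auto simp: symmetric_def intro: symI)
  have conn: "Digraph_Component.connected (with_proj ?T)"
    by (auto simp: connected_conv)
  have ind: "with_proj ?T \<restriction> {0} = with_proj ?T"
    by (simp add: induce_subgraph_def with_proj_def)
  have "\<not> (\<exists>p. pre_digraph.cycle (with_proj ?T) p \<and> length p \<ge> 3)"
    by (auto simp: pre_digraph.cycle_def pre_digraph.awalk_def)
  then have "tree_decomposition G ?T (\<lambda>_. pverts G)"
    using T conn G.in_arcsD1 G.in_arcsD2
    by (auto simp: tree_decomposition_def undirected_tree_def ind)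
  then show ?thesis by blast
qed

lemma Least_int_props:
  fixes P :: "int \<Rightarrow> bool"
  assumes ex: "P a" and lb: "\<And>w. P w \<Longrightarrow> b \<le> w"
  shows "P (LEAST w. P w)" and "P w \<Longrightarrow> (LEAST w. P w) \<le> w"
proof -
  define n where "n = (LEAST n. P (b + int n))"
  have "P (b + int (nat (a - b)))" using ex lb[OF ex] by simp
  then have n: "P (b + int n)" unfolding n_def by (rule LeastI)
  have le: "b + int n \<le> w" if "P w" for w
  proof -
    have "P (b + int (nat (w - b)))" using that lb[OF that] by simp
    then have "n \<le> nat (w - b)" unfolding n_def by (rule Least_le)
    then show ?thesis using lb[OF that] by linarith
  qed
  have "(LEAST w. P w) = b + int n" using n le by (rule Least_equality)
  then show "P (LEAST w. P w)" and "P w \<Longrightarrow> (LEAST w. P w) \<le> w" using n le by auto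
qed

lemma treewidth_props:
  assumes "pair_graph G"
  shows treewidth_attained: "\<exists>(T :: nat pair_pre_digraph) bag.
      tree_decomposition G T bag \<and> treewidth G = decomposition_width T bag"
    and treewidth_le: "\<And>(T :: nat pair_pre_digraph) bag.
      tree_decomposition G T bag \<Longrightarrow> treewidth G \<le> decomposition_width T bag"
proof -
  let ?P = "\<lambda>w. \<exists>(T :: nat pair_pre_digraph) bag.
      tree_decomposition G T bag \<and> w = decomposition_width T bag"
  obtain a where a: "?P a" using tree_decomposition_exists[OF assms] by blast
  have lb: "- 1 \<le> w" if "?P w" for w using that by (auto simp: decomposition_width_def)
  show "?P (treewidth G)" unfolding treewidth_def by (rule Least_int_props(1)[of ?P, OF a lb])
  show "treewidth G \<le> decomposition_width T bag"
    if "tree_decomposition G T bag" for T :: "nat pair_pre_digraph" and bag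
    unfolding treewidth_def using that by (intro Least_int_props(2)[of ?P, OF a lb]) auto
qed

end

theory Submission
  imports Defs
begin

text \<open>
  Put \<open>a = 3k\<close>, \<open>m = 4k(r - 1) + 1\<close>, \<open>n = am\<close> and \<open>h = (2a - 1)(2m - 1) + m\<close>. A tree decomposition with bags of
  at most \<open>h + n - 1\<close> vertices is grown from a root bag. While a connected part \<open>C\<close> is still to be
  decomposed, its attachment set \<open>X\<close> has at most \<open>h\<close> vertices and lies on a connected structure of
  maximum degree three outside \<open>C\<close>, as in the mesh argument of Diestel, Jensen, Gorbunov and Thomassen.
  If \<open>|X| < h\<close>, one vertex of \<open>C\<close> is added. If \<open>|X| = h\<close>, the structure splits into \<open>2a\<close> connected
  pieces with \<open>m\<close> vertices of \<open>X\<close> each; let \<open>Y\<close> be the \<open>n\<close> vertices of the first \<open>a\<close> pieces and \<open>Z\<close>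
  those of the others. Either fewer than \<open>n\<close> vertices separate \<open>Y\<close> from \<open>Z\<close> through \<open>C\<close>, and adding them
  to \<open>X\<close> gives the next bag, or by Menger's theorem there are \<open>n\<close> disjoint links through \<open>C\<close>. In the
  second case counting yields \<open>k\<close> disjoint pairs of pieces joined by at least \<open>r\<close> links each, that is,
  \<open>k\<close> disjoint copies of the complete bipartite graph with parts of sizes 2 and \<open>r\<close>.
\<close>

section \<open>Connected vertex sets\<close>

text \<open>The constants come from two counts. Splitting off one piece after another costs at most
  \<open>2m - 1\<close> attachment vertices per piece and leaves \<open>m\<close> for the last, so
  \<open>2a\<close> pieces need \<open>h\<close> of them; \<open>a\<close> and \<open>m\<close> are
  chosen so that a greedy choice of heavy pairs survives \<open>k\<close> rounds. A bag has at most
  \<open>h\<close> old and fewer than \<open>n\<close> new vertices, which with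
  \<open>s = r - 1\<close> gives width at most \<open>60k^2s + 9k - 4ks - 2\<close>. The obstacle is
  to keep the structure of degree three alive. The part left after a separation has new attachment
  vertices, which must be tied to the old structure outside that part and without overloading a
  node. A separator of least size is linked disjointly from \<open>Y\<close> and from
  \<open>Z\<close>; and since no part sees both \<open>Y\<close> and \<open>Z\<close> beyond the
  separator, one of the two sides has degrees to spare. Paths do not occur. Connected sets replace
  them, and where a path is wanted a connected set of least size serves. Connectedness is stated by
  closed sets, so a proof only has to exhibit an invariant \<open>D\<close>; the relation may live
  on vertices, on tree nodes or on sets of vertices.\<close>

definition conn :: "'a rel \<Rightarrow> 'a set \<Rightarrow> bool" where
  "conn E S \<longleftrightarrow> S \<noteq> {} \<and>
     (\<forall>D. D \<inter> S \<noteq> {} \<longrightarrow> (\<forall>u\<in>D \<inter> S. \<forall>v\<in>S. (u, v) \<in> E \<longrightarrow> v \<in> D) \<longrightarrow> S \<subseteq> D)"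

lemma connI:
  assumes "S \<noteq> {}"
    and "\<And>D. \<lbrakk>D \<inter> S \<noteq> {}; \<And>u v. \<lbrakk>u \<in> D; u \<in> S; v \<in> S; (u, v) \<in> E\<rbrakk> \<Longrightarrow> v \<in> D\<rbrakk> \<Longrightarrow> S \<subseteq> D"
  shows "conn E S"
  using assms unfolding conn_def by blast

lemma conn_closed:
  assumes "conn E S" "D \<inter> S \<noteq> {}"
    and "\<And>u v. \<lbrakk>u \<in> D; u \<in> S; v \<in> S; (u, v) \<in> E\<rbrakk> \<Longrightarrow> v \<in> D"
  shows "S \<subseteq> D"
  using assms unfolding conn_def by blast

lemma conn_nonempty: "conn E S \<Longrightarrow> S \<noteq> {}"
  by (simp add: conn_def)

lemma conn_singleton: "conn E {x}"
  by (rule connI) auto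

lemma conn_mono: "conn E S \<Longrightarrow> E \<subseteq> E' \<Longrightarrow> conn E' S"
  unfolding conn_def by (meson subsetD)

lemma conn_crossing:
  assumes "conn E S" "D \<inter> S \<noteq> {}" "\<not> S \<subseteq> D"
  obtains u v where "u \<in> D" "u \<in> S" "v \<in> S" "v \<notin> D" "(u, v) \<in> E"
  using assms conn_closed[of E S D] by blast

lemma conn_Un:
  assumes "sym E" "conn E A" "conn E B" "A \<inter> B \<noteq> {} \<or> (\<exists>a\<in>A. \<exists>b\<in>B. (a, b) \<in> E)"
  shows "conn E (A \<union> B)"
proof (rule connI)
  show "A \<union> B \<noteq> {}" using conn_nonempty[OF assms(2)] by simp
  fix D assume D: "D \<inter> (A \<union> B) \<noteq> {}"
    "\<And>u v. \<lbrakk>u \<in> D; u \<in> A \<union> B; v \<in> A \<union> B; (u, v) \<in> E\<rbrakk> \<Longrightarrow> v \<in> D"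
  have A: "A \<subseteq> D" if "D \<inter> A \<noteq> {}" using conn_closed[OF assms(2) that] D(2) by blast
  have B: "B \<subseteq> D" if "D \<inter> B \<noteq> {}" using conn_closed[OF assms(3) that] D(2) by blast
  have "D \<inter> A \<noteq> {} \<longleftrightarrow> D \<inter> B \<noteq> {}"
    using A B D(2) assms(4) symD[OF assms(1)] by blast
  then show "A \<union> B \<subseteq> D" using A B D(1) by blast
qed

lemma conn_UN:
  assumes "sym E" and nodes: "conn F I" and sets: "\<And>i. i \<in> I \<Longrightarrow> conn E (A i)"
    and adj: "\<And>i j. \<lbrakk>i \<in> I; j \<in> I; (i, j) \<in> F\<rbrakk> \<Longrightarrow> \<exists>a\<in>A i. \<exists>b\<in>A j. (a, b) \<in> E"
  shows "conn E (\<Union>i\<in>I. A i)"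
proof (rule connI)
  show "(\<Union>i\<in>I. A i) \<noteq> {}" using conn_nonempty[OF nodes] conn_nonempty[OF sets] by blast
  fix D assume D: "D \<inter> (\<Union>i\<in>I. A i) \<noteq> {}"
    "\<And>u v. \<lbrakk>u \<in> D; u \<in> (\<Union>i\<in>I. A i); v \<in> (\<Union>i\<in>I. A i); (u, v) \<in> E\<rbrakk> \<Longrightarrow> v \<in> D"
  have A: "A i \<subseteq> D" if "i \<in> I" "D \<inter> A i \<noteq> {}" for i
    using conn_closed[OF sets[OF that(1)] that(2)] D(2) that(1) by blast
  have "I \<subseteq> {i \<in> I. A i \<subseteq> D}"
  proof (rule conn_closed[OF nodes])
    show "{i \<in> I. A i \<subseteq> D} \<inter> I \<noteq> {}" using D(1) A by blast
    fix i j assume ij: "i \<in> {i \<in> I. A i \<subseteq> D}" "j \<in> I" "(i, j) \<in> F"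
    then obtain a b where "a \<in> A i" "b \<in> A j" "(a, b) \<in> E" using adj by blast
    then have "b \<in> D" using D(2)[of a b] ij by blast
    then show "j \<in> {i \<in> I. A i \<subseteq> D}" using A \<open>b \<in> A j\<close> ij by blast
  qed
  then show "(\<Union>i\<in>I. A i) \<subseteq> D" by blast
qed

section \<open>Components of an induced subgraph\<close>

definition component :: "'a rel \<Rightarrow> 'a set \<Rightarrow> 'a \<Rightarrow> 'a set" where
  "component E S x = \<Union>{A. A \<subseteq> S \<and> x \<in> A \<and> conn E A}"

lemma component_subset: "component E S x \<subseteq> S"
  by (auto simp: component_def)

lemma component_self: "x \<in> S \<Longrightarrow> x \<in> component E S x"
  unfolding component_def using conn_singleton[of E x] by blast

lemma conn_component:
  assumes "x \<in> S"
  shows "conn E (component E S x)"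
proof (rule connI)
  show "component E S x \<noteq> {}" using component_self[OF assms] by blast
  fix D assume D: "D \<inter> component E S x \<noteq> {}"
    "\<And>u v. \<lbrakk>u \<in> D; u \<in> component E S x; v \<in> component E S x; (u, v) \<in> E\<rbrakk> \<Longrightarrow> v \<in> D"
  have A: "A \<subseteq> D" if "A \<subseteq> S" "x \<in> A" "conn E A" "D \<inter> A \<noteq> {}" for A
  proof (rule conn_closed[OF that(3,4)])
    have "A \<subseteq> component E S x" using that unfolding component_def by blast
    then show "\<And>u v. \<lbrakk>u \<in> D; u \<in> A; v \<in> A; (u, v) \<in> E\<rbrakk> \<Longrightarrow> v \<in> D" using D(2) by blast
  qed
  then have "x \<in> D" using D(1) unfolding component_def by blast
  then show "component E S x \<subseteq> D" using A unfolding component_def by blast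
qed

lemma component_maximal:
  assumes "sym E" "x \<in> S" "conn E A" "A \<subseteq> S" "A \<inter> component E S x \<noteq> {}"
  shows "A \<subseteq> component E S x"
proof -
  have "conn E (A \<union> component E S x)"
    by (rule conn_Un[OF assms(1,3) conn_component[OF assms(2)]]) (use assms in simp)
  moreover have "A \<union> component E S x \<subseteq> S" "x \<in> A \<union> component E S x"
    using assms(4) component_subset[of E S x] component_self[OF assms(2)] by blast+
  ultimately show ?thesis unfolding component_def[of E S x] by blast
qed

lemma component_step:
  assumes "sym E" "x \<in> S" "u \<in> component E S x" "v \<in> S" "(u, v) \<in> E"
  shows "v \<in> component E S x"
proof -
  have "conn E (component E S x \<union> {v})"
    by (rule conn_Un[OF assms(1) conn_component[OF assms(2)] conn_singleton]) (use assms in blast)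
  moreover have "component E S x \<union> {v} \<subseteq> S" using assms(4) component_subset[of E S x] by simp
  ultimately have "component E S x \<union> {v} \<subseteq> component E S x"
    using assms(3) by (intro component_maximal[OF assms(1,2)]) auto
  then show ?thesis by simp
qed

lemma component_eq:
  assumes "sym E" "x \<in> S" "y \<in> component E S x"
  shows "component E S y = component E S x"
proof -
  have y: "y \<in> S" using assms(3) component_subset[of E S x] by blast
  show ?thesis
    using component_maximal[OF assms(1) assms(2) conn_component[OF y] component_subset]
      component_maximal[OF assms(1) y conn_component[OF assms(2)] component_subset]
      assms(3) component_self[OF y] by blast
qed

text \<open>Substitute for a shortest path from \<open>s\<close> to \<open>A\<close>: take
  \<open>Q\<close> of least size among the connected subsets of \<open>P\<close> that contain
  \<open>s\<close> and meet \<open>A\<close>. The component of \<open>s\<close> in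
  \<open>Q - A\<close> together with one adjacent vertex of \<open>A\<close> is again such a set,
  hence all of \<open>Q\<close>; from the other end the component of \<open>y\<close> in
  \<open>Q - {s}\<close> does the same. So either end can be removed without disconnecting
  \<open>Q\<close>.\<close>

lemma conn_between:
  assumes "sym E" "finite P" "conn E P" "P \<inter> A \<noteq> {}" "s \<in> P" "s \<notin> A"
  obtains Q y where "Q \<subseteq> P" "Q \<inter> A = {y}" "s \<in> Q" "conn E Q" "conn E (Q - {y})" "conn E (Q - {s})"
proof -
  let ?ok = "\<lambda>Q. Q \<subseteq> P \<and> Q \<inter> A \<noteq> {} \<and> s \<in> Q \<and> conn E Q"
  have "\<exists>Q. ?ok Q \<and> (\<forall>Q'. ?ok Q' \<longrightarrow> card Q \<le> card Q')"
    by (rule ex_has_least_nat[of ?ok P]) (use assms in auto)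
  then obtain Q where ok: "?ok Q" and least: "\<forall>Q'. ?ok Q' \<longrightarrow> card Q \<le> card Q'"
    by (elim exE conjE) (rule that, auto)
  have Q: "Q \<subseteq> P" "Q \<inter> A \<noteq> {}" "s \<in> Q" "conn E Q" using ok by auto
  have min: "Q' = Q" if "Q' \<subseteq> Q" "Q' \<inter> A \<noteq> {}" "s \<in> Q'" "conn E Q'" for Q'
  proof (rule card_seteq)
    show "finite Q" using Q(1) assms(2) finite_subset by blast
    show "card Q \<le> card Q'" using least that Q(1) by simp
  qed fact
  have sQ: "s \<in> Q - A" using Q(3) assms(6) by blast
  let ?R = "component E (Q - A) s"
  have R: "?R \<subseteq> Q - A" "s \<in> ?R" "conn E ?R"
    using component_subset[of E "Q - A" s] component_self[OF sQ] conn_component[OF sQ] by simp_all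
  have "?R \<inter> Q \<noteq> {}" "\<not> Q \<subseteq> ?R" using R Q(2,3) by blast+
  then obtain u y where uy: "u \<in> ?R" "y \<in> Q" "y \<notin> ?R" "(u, y) \<in> E"
    by (rule conn_crossing[OF Q(4)])
  have yA: "y \<in> A" using component_step[OF assms(1) sQ uy(1) _ uy(4)] uy(2,3) by blast
  have "conn E (?R \<union> {y})"
    by (rule conn_Un[OF assms(1) R(3) conn_singleton]) (use uy in blast)
  then have Qy: "?R \<union> {y} = Q"
    using R uy(2) yA by (intro min) auto
  have ys: "y \<in> Q - {s}" using uy(2) yA assms(6) by blast
  let ?R' = "component E (Q - {s}) y"
  have R': "?R' \<subseteq> Q - {s}" "y \<in> ?R'" "conn E ?R'"
    using component_subset[of E "Q - {s}" y] component_self[OF ys] conn_component[OF ys] by simp_all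
  have "?R' \<inter> Q \<noteq> {}" "\<not> Q \<subseteq> ?R'" using R' Q(3) by blast+
  then obtain u' v where uv: "u' \<in> ?R'" "v \<in> Q" "v \<notin> ?R'" "(u', v) \<in> E"
    by (rule conn_crossing[OF Q(4)])
  have "v = s" using component_step[OF assms(1) ys uv(1) _ uv(4)] uv(2,3) by blast
  then have "conn E (?R' \<union> {s})"
    by (intro conn_Un[OF assms(1) R'(3) conn_singleton]) (use uv in blast)
  then have Qs: "?R' \<union> {s} = Q"
    using R' Q(3) yA by (intro min) auto
  have "Q - {y} = ?R" "Q \<inter> A = {y}" using Qy R(1) yA by blast+
  moreover have "Q - {s} = ?R'" using Qs R'(1) by blast
  ultimately show ?thesis using that[of Q y] Q R(3) R'(3) by simp
qed

section \<open>Menger's theorem for connected sets\<close>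

definition separates :: "'a rel \<Rightarrow> 'a set \<Rightarrow> 'a set \<Rightarrow> 'a set \<Rightarrow> 'a set \<Rightarrow> bool" where
  "separates E U X A B \<longleftrightarrow>
     (\<forall>P\<subseteq>U. conn E P \<longrightarrow> P \<inter> A \<noteq> {} \<longrightarrow> P \<inter> B \<noteq> {} \<longrightarrow> P \<inter> X \<noteq> {})"

lemma separates_commute: "separates E U X A B \<longleftrightarrow> separates E U X B A"
  unfolding separates_def by blast

lemma separates_Diff:
  assumes "separates E (U - W) X (A - W) (B - W)"
  shows "separates E U (W \<union> X) A B"
  unfolding separates_def
proof (intro allI impI)
  fix P assume P: "P \<subseteq> U" "conn E P" "P \<inter> A \<noteq> {}" "P \<inter> B \<noteq> {}"
  show "P \<inter> (W \<union> X) \<noteq> {}"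
    using assms P unfolding separates_def by (cases "P \<inter> W = {}") blast+
qed

text \<open>Pigeonhole: disjoint sets that all meet \<open>X\<close> pick distinct vertices of
  \<open>X\<close>; there are as many sets as vertices, so every vertex is picked and no set
  contains a second one. This turns a linkage as large as its end set into a bijection.\<close>

lemma transversal:
  assumes "finite X" "finite \<P>" "card \<P> = card X" "disjoint \<P>" "\<And>P. P \<in> \<P> \<Longrightarrow> P \<inter> X \<noteq> {}"
  obtains f where "bij_betw f X \<P>" "\<And>x. x \<in> X \<Longrightarrow> f x \<inter> X = {x}"
proof -
  have "\<forall>P\<in>\<P>. \<exists>x. x \<in> P \<inter> X" using assms(5) by blast
  from bchoice[OF this] obtain g where g: "\<And>P. P \<in> \<P> \<Longrightarrow> g P \<in> P \<inter> X" by blast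
  have inj: "inj_on g \<P>"
  proof (rule inj_onI)
    fix P Q assume PQ: "P \<in> \<P>" "Q \<in> \<P>" "g P = g Q"
    then have "P \<inter> Q \<noteq> {}" using g[OF PQ(1)] g[OF PQ(2)] by auto
    then show "P = Q" using disjointD[OF assms(4) PQ(1,2)] by blast
  qed
  have im: "g ` \<P> = X"
    using g assms inj by (intro card_subset_eq) (auto simp: card_image)
  have bij: "bij_betw (inv_into \<P> g) X \<P>"
    by (rule bij_betw_inv_into) (use inj im in \<open>auto simp: bij_betw_def\<close>)
  have "inv_into \<P> g x \<inter> X = {x}" if x: "x \<in> X" for x
  proof -
    obtain P where P: "P \<in> \<P>" "x = g P" using x im by blast
    then have eq: "inv_into \<P> g x = P" using inj by simp
    have "y = x" if y: "y \<in> P" "y \<in> X" for y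
    proof -
      obtain Q where Q: "Q \<in> \<P>" "y = g Q" using y im by blast
      then have "P \<inter> Q \<noteq> {}" using g[OF Q(1)] y by auto
      then show ?thesis using disjointD[OF assms(4) P(1) Q(1)] P Q by auto
    qed
    then show ?thesis using eq g P by auto
  qed
  with bij that show ?thesis by blast
qed

text \<open>Members are connected sets and not paths, so a member may meet \<open>A\<close> or
  \<open>B\<close> more than once. Where single ends matter, \<open>transversal\<close> or
  \<open>conn_between\<close> provides them.\<close>

definition linkage :: "'a rel \<Rightarrow> 'a set \<Rightarrow> 'a set \<Rightarrow> 'a set \<Rightarrow> 'a set set \<Rightarrow> bool" where
  "linkage E U A B \<P> \<longleftrightarrow> finite \<P> \<and> disjoint \<P> \<and>
     (\<forall>P\<in>\<P>. P \<subseteq> U \<and> conn E P \<and> P \<inter> A \<noteq> {} \<and> P \<inter> B \<noteq> {})"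

lemma linkageD:
  assumes "linkage E U A B \<P>"
  shows "finite \<P>" "disjoint \<P>"
    and "P \<in> \<P> \<Longrightarrow> P \<subseteq> U \<and> conn E P \<and> P \<inter> A \<noteq> {} \<and> P \<inter> B \<noteq> {}"
  using assms unfolding linkage_def by auto

lemma linkage_mono:
  assumes "linkage E U A B \<P>" "U \<subseteq> U'" "A \<subseteq> A'" "B \<subseteq> B'"
  shows "linkage E U' A' B' \<P>"
  unfolding linkage_def
proof (intro conjI ballI)
  fix P assume "P \<in> \<P>"
  from linkageD(3)[OF assms(1) this] show "P \<subseteq> U'" "conn E P" "P \<inter> A' \<noteq> {}" "P \<inter> B' \<noteq> {}"
    using assms(2-) by blast+
qed (use linkageD(1,2)[OF assms(1)] in simp_all)

lemma linkage_insert: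
  assumes "linkage E (U - W) (A - W) (B - W) \<P>" "P \<subseteq> U" "P \<subseteq> W" "conn E P"
    and "P \<inter> A \<noteq> {}" "P \<inter> B \<noteq> {}"
  shows "linkage E U A B (insert P \<P>)" and "card (insert P \<P>) = Suc (card \<P>)"
proof -
  note Q = linkageD[OF assms(1)]
  have PQ: "P \<inter> Q = {}" if "Q \<in> \<P>" for Q using Q(3)[OF that] assms(3) by blast
  then have "P \<notin> \<P>" using conn_nonempty[OF assms(4)] by auto
  with Q(1) show "card (insert P \<P>) = Suc (card \<P>)" by simp
  have "disjoint (insert P \<P>)" using Q(2) PQ by (auto simp: pairwise_insert disjnt_def)
  then show "linkage E U A B (insert P \<P>)"
    unfolding linkage_def using Q assms by blast
qed

text \<open>\<open>X\<close> belongs to the side, so that it can be an end set of the subproblem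
  posed there.\<close>

definition side :: "'a rel \<Rightarrow> 'a set \<Rightarrow> 'a set \<Rightarrow> 'a set \<Rightarrow> 'a set" where
  "side E U X A = X \<union> {u. \<exists>P\<subseteq>U - X. conn E P \<and> u \<in> P \<and> P \<inter> A \<noteq> {}}"

lemma side_subset: "X \<subseteq> U \<Longrightarrow> side E U X A \<subseteq> U"
  unfolding side_def by blast

lemma subset_side: "A \<subseteq> U \<Longrightarrow> A \<subseteq> side E U X A"
proof
  fix a assume "A \<subseteq> U" "a \<in> A"
  then show "a \<in> side E U X A"
    unfolding side_def using conn_singleton[of E a] by (cases "a \<in> X") blast+
qed

lemma side_Int:
  assumes "sym E" "separates E U X A B"
  shows "side E U X A \<inter> side E U X B = X"
proof -
  have False if P: "P \<subseteq> U - X" "conn E P" "u \<in> P" "P \<inter> A \<noteq> {}"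
    and Q: "Q \<subseteq> U - X" "conn E Q" "u \<in> Q" "Q \<inter> B \<noteq> {}" for u P Q
  proof -
    have "conn E (P \<union> Q)" using conn_Un[OF assms(1) P(2) Q(2)] P Q by blast
    moreover have "P \<union> Q \<subseteq> U" "(P \<union> Q) \<inter> A \<noteq> {}" "(P \<union> Q) \<inter> B \<noteq> {}" "(P \<union> Q) \<inter> X = {}"
      using P Q by auto
    ultimately show False using assms(2) unfolding separates_def by blast
  qed
  then show ?thesis unfolding side_def by blast
qed

text \<open>A connected \<open>P\<close> from \<open>A\<close> to \<open>B\<close> hits
  \<open>X\<close>. If the component of \<open>a\<close> in the part of \<open>P\<close> on the
  \<open>A\<close>-side missed \<open>X\<close>, the vertex by which \<open>P\<close> leaves it
  would lie in \<open>X\<close> or be reachable from \<open>A\<close> off \<open>X\<close>, hence on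
  the side after all. So this component runs from \<open>A\<close> to \<open>X\<close> and meets
  \<open>W\<close>.\<close>

lemma side_separates:
  assumes "sym E" "X \<subseteq> U" "A \<subseteq> U" "separates E U X A B"
    and W: "separates E (side E U X A) W A X"
  shows "separates E U W A B"
  unfolding separates_def
proof (intro allI impI)
  fix P assume P: "P \<subseteq> U" "conn E P" "P \<inter> A \<noteq> {}" "P \<inter> B \<noteq> {}"
  then have PX: "P \<inter> X \<noteq> {}" using assms(4) unfolding separates_def by blast
  obtain a where a: "a \<in> P" "a \<in> A" using P(3) by blast
  let ?S = "P \<inter> side E U X A" and ?Q = "component E (P \<inter> side E U X A) a"
  have aS: "a \<in> ?S" using a subset_side[OF assms(3)] by blast
  have Q: "?Q \<subseteq> ?S" "a \<in> ?Q" "conn E ?Q"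
    using component_subset[of E ?S a] component_self[OF aS] conn_component[OF aS] by simp_all
  have "?Q \<inter> X \<noteq> {}"
  proof
    assume QX: "?Q \<inter> X = {}"
    then have "?Q \<inter> P \<noteq> {}" "\<not> P \<subseteq> ?Q" using Q a PX by blast+
    then obtain u v where uv: "u \<in> ?Q" "v \<in> P" "v \<notin> ?Q" "(u, v) \<in> E"
      by (rule conn_crossing[OF P(2)])
    have "conn E (?Q \<union> {v})" using conn_Un[OF assms(1) Q(3) conn_singleton] uv by blast
    moreover have "?Q \<union> {v} \<subseteq> U - X" if "v \<notin> X" using that QX Q(1) P(1) uv(2) by blast
    moreover have "v \<in> ?Q \<union> {v}" "(?Q \<union> {v}) \<inter> A \<noteq> {}" using Q(2) a(2) by auto
    ultimately have "v \<in> side E U X A" unfolding side_def by blast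
    then show False using component_step[OF assms(1) aS uv(1) _ uv(4)] uv by blast
  qed
  then have "?Q \<inter> W \<noteq> {}"
    using W Q a(2) unfolding separates_def by blast
  then show "P \<inter> W \<noteq> {}" using Q by blast
qed

text \<open>Each member meets \<open>X\<close> in exactly one vertex, and members from different
  sides overlap only in \<open>X\<close>. Joining the two members at the same vertex of
  \<open>X\<close> therefore keeps the family disjoint.\<close>

lemma linkage_glue:
  assumes "sym E" "finite X" "V \<inter> V' = X" "V \<subseteq> U" "V' \<subseteq> U"
    and L: "linkage E V A X \<P>" "card \<P> = card X"
    and L': "linkage E V' B X \<P>'" "card \<P>' = card X"
  shows "\<exists>\<R>. linkage E U A B \<R> \<and> card \<R> = card X"
proof -
  note P = linkageD[OF L(1)] and P' = linkageD[OF L'(1)]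
  obtain f where f: "bij_betw f X \<P>" "\<And>x. x \<in> X \<Longrightarrow> f x \<inter> X = {x}"
    by (rule transversal[OF assms(2) P(1) L(2) P(2)]) (use P(3) in simp, blast)
  obtain g where g: "bij_betw g X \<P>'" "\<And>x. x \<in> X \<Longrightarrow> g x \<inter> X = {x}"
    by (rule transversal[OF assms(2) P'(1) L'(2) P'(2)]) (use P'(3) in simp, blast)
  have fP: "f x \<in> \<P>" "g x \<in> \<P>'" if "x \<in> X" for x
    using f(1) g(1) that by (auto simp: bij_betw_def)
  let ?R = "\<lambda>x. f x \<union> g x"
  have dis: "?R x \<inter> ?R y = {}" if "x \<in> X" "y \<in> X" "x \<noteq> y" for x y
  proof -
    have "f x \<noteq> f y" "g x \<noteq> g y" using f(1) g(1) that by (auto simp: bij_betw_def inj_on_def)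
    then have "f x \<inter> f y = {}" "g x \<inter> g y = {}"
      using disjointD[OF P(2) fP(1) fP(1)] disjointD[OF P'(2) fP(2) fP(2)] that by auto
    moreover have "f x \<inter> g y \<subseteq> X" "g x \<inter> f y \<subseteq> X"
      using P(3)[OF fP(1)] P'(3)[OF fP(2)] that assms(3) by blast+
    moreover have "(f x \<inter> X) \<inter> (g y \<inter> X) = {}" "(g x \<inter> X) \<inter> (f y \<inter> X) = {}"
      using that by (simp_all add: f(2) g(2))
    ultimately show ?thesis by blast
  qed
  have con: "conn E (?R x) \<and> ?R x \<subseteq> U \<and> ?R x \<inter> A \<noteq> {} \<and> ?R x \<inter> B \<noteq> {}" if "x \<in> X" for x
  proof -
    have "x \<in> f x \<inter> g x" using f(2)[OF that] g(2)[OF that] by blast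
    then have "conn E (?R x)"
      using conn_Un[OF assms(1)] P(3)[OF fP(1)[OF that]] P'(3)[OF fP(2)[OF that]] by blast
    then show ?thesis using P(3)[OF fP(1)[OF that]] P'(3)[OF fP(2)[OF that]] assms(4,5) by blast
  qed
  have "inj_on ?R X"
  proof (rule inj_onI)
    fix x y assume xy: "x \<in> X" "y \<in> X" "?R x = ?R y"
    have "x \<in> ?R x" using f(2)[OF xy(1)] by blast
    then show "x = y" using dis[OF xy(1,2)] xy(3) by blast
  qed
  then have "card (?R ` X) = card X" by (rule card_image)
  moreover have "disjoint (?R ` X)"
  proof (rule disjointI)
    fix a b assume "a \<in> ?R ` X" "b \<in> ?R ` X" "a \<noteq> b"
    then obtain x y where "x \<in> X" "y \<in> X" "a = ?R x" "b = ?R y" "x \<noteq> y" by blast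
    then show "a \<inter> b = {}" using dis by simp
  qed
  then have "linkage E U A B (?R ` X)"
    unfolding linkage_def using assms(2) con by simp
  ultimately show ?thesis by blast
qed

text \<open>
  Induction on \<open>U\<close>. A separator of size \<open>n\<close> other than \<open>A\<close> and \<open>B\<close> splits the problem. If there is none, a
  vertex can be deleted unless \<open>U\<close> is the disjoint union of \<open>A\<close> and \<open>B\<close>, both of size \<open>n\<close>, where the two
  ends of an arc between \<open>A\<close> and \<open>B\<close> are deleted.
\<close>

theorem menger:
  assumes "sym E" "finite U" "A \<subseteq> U" "B \<subseteq> U"
    and "\<And>X. \<lbrakk>X \<subseteq> U; separates E U X A B\<rbrakk> \<Longrightarrow> n \<le> card X"
  shows "\<exists>\<P>. linkage E U A B \<P> \<and> card \<P> = n"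
  using assms(2-)
proof (induction "card U" arbitrary: U A B n rule: less_induct)
  case less
  note fin = less.prems(1) and AU = less.prems(2) and BU = less.prems(3) and ge = less.prems(4)
  have IH: "\<exists>\<P>. linkage E V A' B' \<P> \<and> card \<P> = n'"
    if "V \<subset> U" "A' \<subseteq> V" "B' \<subseteq> V" "\<And>X. \<lbrakk>X \<subseteq> V; separates E V X A' B'\<rbrakk> \<Longrightarrow> n' \<le> card X"
    for V A' B' n'
    by (rule less.hyps[OF psubset_card_mono[OF fin that(1)] _ that(2-4)])
      (use that(1) fin in \<open>auto intro: finite_subset\<close>)
  have sepAB: "separates E U A A B" "separates E U B A B" unfolding separates_def by blast+
  have finAB: "finite A" "finite B" using fin AU BU finite_subset by blast+
  consider (zero) "n = 0" | (meet) v where "v \<in> A" "v \<in> B" "n > 0"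
    | (proper) X where "X \<subseteq> U" "separates E U X A B" "card X = n" "X \<noteq> A" "X \<noteq> B"
    | (rest) "n > 0" "A \<inter> B = {}"
        "\<And>X. \<lbrakk>X \<subseteq> U; separates E U X A B; card X = n\<rbrakk> \<Longrightarrow> X = A \<or> X = B"
    by blast
  then show ?case
  proof cases
    case zero
    then show ?thesis by (intro exI[of _ "{}"]) (simp add: linkage_def)
  next
    case meet
    have "\<exists>\<P>. linkage E (U - {v}) (A - {v}) (B - {v}) \<P> \<and> card \<P> = n - 1"
    proof (rule IH)
      fix X assume X: "X \<subseteq> U - {v}" "separates E (U - {v}) X (A - {v}) (B - {v})"
      have "n \<le> card ({v} \<union> X)"
        by (rule ge[OF _ separates_Diff[OF X(2)]]) (use X meet AU in auto)
      also have "\<dots> \<le> card X + 1" using card_Un_le[of "{v}" X] by simp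
      finally show "n - 1 \<le> card X" by simp
    qed (use AU BU meet in auto)
    then obtain \<P> where P: "linkage E (U - {v}) (A - {v}) (B - {v}) \<P>" "card \<P> = n - 1" by blast
    moreover have "{v} \<subseteq> U" "{v} \<inter> A \<noteq> {}" "{v} \<inter> B \<noteq> {}" using AU meet by auto
    ultimately have "linkage E U A B (insert {v} \<P>)" "card (insert {v} \<P>) = Suc (n - 1)"
      using linkage_insert[OF P(1) _ order_refl conn_singleton] by simp_all
    then show ?thesis using meet(3) by (intro exI[of _ "insert {v} \<P>"]) simp
  next
    case proper
    let ?V = "side E U X A" and ?V' = "side E U X B"
    have sep': "separates E U X B A" using proper(2) separates_commute by blast
    have finX: "finite X" using proper(1) fin finite_subset by blast
    have int: "?V \<inter> ?V' = X" by (rule side_Int[OF assms(1) proper(2)])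
    have sub: "?V \<subseteq> U" "?V' \<subseteq> U" using side_subset[OF proper(1)] by auto
    have "?V \<noteq> U"
    proof
      assume "?V = U"
      then have "B \<subseteq> X" using subset_side[OF BU, of E X] int sub BU by blast
      moreover have "n \<le> card B" using ge[OF BU sepAB(2)] .
      ultimately show False using proper(3,5) finX card_seteq[of X B] by auto
    qed
    moreover have "?V' \<noteq> U"
    proof
      assume "?V' = U"
      then have "A \<subseteq> X" using subset_side[OF AU, of E X] int sub AU by blast
      moreover have "n \<le> card A" using ge[OF AU sepAB(1)] .
      ultimately show False using proper(3,4) finX card_seteq[of X A] by auto
    qed
    ultimately have V: "?V \<subset> U" "?V' \<subset> U" using sub by auto
    have "\<exists>\<P>. linkage E ?V A X \<P> \<and> card \<P> = n"
      by (rule IH) (use V subset_side[OF AU, of E X] int ge sub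
          side_separates[OF assms(1) proper(1) AU proper(2)] in auto)
    moreover have "\<exists>\<P>. linkage E ?V' B X \<P> \<and> card \<P> = n"
      by (rule IH) (use V subset_side[OF BU, of E X] int ge sub
          side_separates[OF assms(1) proper(1) BU sep'] separates_commute[of E U _ A B] in auto)
    then obtain \<P> \<P>' where "linkage E ?V A X \<P>" "card \<P> = n" "linkage E ?V' B X \<P>'" "card \<P>' = n"
      using calculation by (elim exE conjE)
    then show ?thesis
      using linkage_glue[OF assms(1) finX int sub] proper(3) by simp
  next
    case rest
    \<comment> \<open>If deleting \<open>W\<close> lowered the separation number by more than
      \<open>card W - 1\<close>, a small separator of the rest together with \<open>W\<close> would
      be one of size exactly \<open>n\<close>, hence \<open>A\<close> or \<open>B\<close>. Then
      \<open>W\<close> would lie in an end set of size \<open>n\<close>, which the last two premises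
      exclude.\<close>
    have insert_ge: "n' \<le> card X" if "X \<subseteq> U - W" "W \<subseteq> U" "W \<noteq> {}" "card W = Suc d" "n = n' + d"
      "separates E (U - W) X (A - W) (B - W)"
      "\<not> (W \<subseteq> A \<and> card A = n)" "\<not> (W \<subseteq> B \<and> card B = n)" for W X n' d
    proof (rule ccontr)
      assume "\<not> n' \<le> card X"
      moreover have WX: "W \<union> X \<subseteq> U" "separates E U (W \<union> X) A B"
        using that(1,2) separates_Diff[OF that(6)] by auto
      moreover have "n \<le> card (W \<union> X)" by (rule ge[OF WX])
      moreover have "card (W \<union> X) \<le> Suc d + card X" using card_Un_le[of W X] that by simp
      ultimately have "card (W \<union> X) = n" using that by simp
      moreover have "W \<union> X = A \<or> W \<union> X = B"
        by (rule rest(3)[OF WX]) fact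
      ultimately show False using that by blast
    qed
    show ?thesis
    proof (cases "\<exists>v\<in>U. \<not> (v \<in> A \<and> card A = n) \<and> \<not> (v \<in> B \<and> card B = n)")
      case True
      then obtain v where v: "v \<in> U" "\<not> (v \<in> A \<and> card A = n)" "\<not> (v \<in> B \<and> card B = n)" by blast
      have "\<exists>\<P>. linkage E (U - {v}) (A - {v}) (B - {v}) \<P> \<and> card \<P> = n"
      proof (rule IH)
        fix X assume "X \<subseteq> U - {v}" "separates E (U - {v}) X (A - {v}) (B - {v})"
        then show "n \<le> card X" using insert_ge[of X "{v}" 0 n] v by auto
      qed (use AU BU v in auto)
      then show ?thesis
        by (elim exE conjE) (intro exI conjI, erule linkage_mono, auto)
    next
      case False
      have "\<not> separates E U {} A B" using ge[of "{}"] rest(1) by auto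
      then obtain P where P: "P \<subseteq> U" "conn E P" "P \<inter> A \<noteq> {}" "P \<inter> B \<noteq> {}"
        unfolding separates_def by blast
      obtain x y where xy: "x \<in> A" "x \<in> P" "y \<in> P" "y \<notin> A" "(x, y) \<in> E"
        using conn_crossing[OF P(2), of A] P rest(2) by blast
      have yB: "y \<in> B" using False xy P by blast
      let ?W = "{x, y}"
      have "x \<noteq> y" using xy by blast
      then have W: "card ?W = Suc 1" by simp
      have "\<exists>\<P>. linkage E (U - ?W) (A - ?W) (B - ?W) \<P> \<and> card \<P> = n - 1"
      proof (rule IH)
        fix X assume X: "X \<subseteq> U - ?W" "separates E (U - ?W) X (A - ?W) (B - ?W)"
        show "n - 1 \<le> card X"
          by (rule insert_ge[OF X(1) _ _ W _ X(2)]) (use AU BU xy yB rest(1,2) in auto)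
      qed (use AU BU xy in auto)
      then obtain \<P> where Q: "linkage E (U - ?W) (A - ?W) (B - ?W) \<P>" "card \<P> = n - 1" by blast
      have "conn E ({x} \<union> {y})"
        by (rule conn_Un[OF assms(1) conn_singleton conn_singleton]) (use xy in blast)
      then have cW: "conn E ?W" by (simp add: insert_commute)
      have WU: "?W \<subseteq> U" "?W \<inter> A \<noteq> {}" "?W \<inter> B \<noteq> {}" using xy yB P by auto
      show ?thesis
        using linkage_insert[OF Q(1) WU(1) order_refl cW WU(2,3)] Q(2) rest(1)
        by (intro exI[of _ "insert ?W \<P>"]) simp
    qed
  qed
qed

text \<open>Passage to the library notion: the vertices reachable from \<open>u\<close> form a set
  closed under the arcs inside \<open>S\<close>, which is the \<open>D\<close> that
  \<open>conn\<close> asks for.\<close>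

lemma connected_induce_subgraph:
  assumes "S \<subseteq> pverts G" "conn (parcs G) S"
  shows "Digraph_Component.connected (with_proj G \<restriction> S)"
proof -
  let ?H = "with_proj (mk_symmetric (with_proj G \<restriction> S))"
  have V: "verts ?H = S" by (simp add: mk_symmetric_def induce_subgraph_def)
  have A: "(v, w) \<in> arcs_ends ?H" if "v \<in> S" "w \<in> S" "(v, w) \<in> parcs G" for v w
    using that by (force simp: mk_symmetric_def induce_subgraph_def arcs_ends_conv)
  have "u \<rightarrow>\<^sup>*\<^bsub>?H\<^esub> v" if uv: "u \<in> S" "v \<in> S" for u v
  proof -
    have "S \<subseteq> {v. u \<rightarrow>\<^sup>*\<^bsub>?H\<^esub> v}"
    proof (rule conn_closed[OF assms(2)])
      show "{v. u \<rightarrow>\<^sup>*\<^bsub>?H\<^esub> v} \<inter> S \<noteq> {}"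
        using uv(1) V by (auto simp: reachable_def)
      fix v w assume "v \<in> {v. u \<rightarrow>\<^sup>*\<^bsub>?H\<^esub> v}" "v \<in> S" "w \<in> S" "(v, w) \<in> parcs G"
      then show "w \<in> {v. u \<rightarrow>\<^sup>*\<^bsub>?H\<^esub> v}"
        using A[of v w] V unfolding reachable_def mem_Collect_eq
        by (metis rtrancl_on_into_rtrancl_on)
    qed
    then show ?thesis using uv(2) by blast
  qed
  then show ?thesis
    unfolding Digraph_Component.connected_def strongly_connected_def
    using V conn_nonempty[OF assms(2)] by simp
qed

section \<open>Bag lists with the running intersection property\<close>

text \<open>A tree decomposition as a list that grows at the front. The set \<open>p\<close> is the
  parent bag of \<open>B\<close>; the root is the last bag.\<close>

inductive rip :: "'a set list \<Rightarrow> bool" where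
  single: "rip [B]"
| Cons: "\<lbrakk>rip bs; p \<in> set bs; B \<inter> \<Union>(set bs) \<subseteq> p\<rbrakk> \<Longrightarrow> rip (B # bs)"

lemma rip_nonempty: "rip bs \<Longrightarrow> bs \<noteq> []"
  by (cases rule: rip.cases) auto

text \<open>The root of \<open>ds\<close> becomes a child of \<open>p\<close>. Every other bag of
  \<open>ds\<close> keeps its parent: what it shares with \<open>bs\<close> lies in
  \<open>last ds\<close>, so it is already accounted for within \<open>ds\<close>.\<close>

lemma rip_append:
  assumes "rip ds" "rip bs" "p \<in> set bs" "\<Union>(set ds) \<inter> \<Union>(set bs) \<subseteq> last ds \<inter> p"
  shows "rip (ds @ bs)"
  using assms
proof (induction ds rule: rip.induct)
  case (single B)
  then show ?case by (auto intro!: rip.Cons)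
next
  case (Cons ds q B)
  have ne: "ds \<noteq> []" using rip_nonempty Cons by blast
  then have last: "last (B # ds) = last ds" "last ds \<in> set ds" by simp_all
  have "\<Union>(set ds) \<inter> \<Union>(set bs) \<subseteq> last ds \<inter> p" using Cons.prems(3) last(1) by auto
  then have "rip (ds @ bs)" by (rule Cons.IH[OF Cons.prems(1,2)])
  moreover have "q \<in> set (ds @ bs)" using Cons by simp
  moreover have "B \<inter> \<Union>(set (ds @ bs)) \<subseteq> q"
  proof -
    have "B \<inter> \<Union>(set bs) \<subseteq> last ds" using Cons.prems(3) last(1) by auto
    then have "B \<inter> \<Union>(set bs) \<subseteq> \<Union>(set ds)" using last(2) by blast
    then show ?thesis using Cons.hyps(3) by auto
  qed
  ultimately show ?case using rip.Cons by fastforce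
qed

text \<open>Reversal puts the root at index 0, and parents get smaller indices than their
  children.\<close>

lemma rip_parent:
  assumes "rip bs" "0 < i" "i < length bs"
  shows "\<exists>p<i. rev bs ! i \<inter> (\<Union>j<i. rev bs ! j) \<subseteq> rev bs ! p"
  using assms
proof (induction bs arbitrary: i rule: rip.induct)
  case (single B)
  then show ?case by simp
next
  case (Cons bs p B)
  have nth: "rev (B # bs) ! j = rev bs ! j" if "j < length bs" for j
    using that by (simp add: nth_append)
  show ?case
  proof (cases "i < length bs")
    case True
    then obtain q where q: "q < i" "rev bs ! i \<inter> (\<Union>j<i. rev bs ! j) \<subseteq> rev bs ! q"
      using Cons.IH[OF Cons.prems(1)] by blast
    have "rev (B # bs) ! i \<inter> (\<Union>j<i. rev (B # bs) ! j) \<subseteq> rev (B # bs) ! q"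
      using q True by (simp add: nth del: rev.simps)
    then show ?thesis using q(1) by blast
  next
    case False
    then have i: "i = length bs" using Cons.prems by simp
    have "p \<in> set (rev bs)" using Cons by simp
    then obtain q where q: "q < length bs" "rev bs ! q = p" by (metis in_set_conv_nth length_rev)
    have "(\<Union>j<i. rev (B # bs) ! j) = \<Union>(set (rev bs))"
      unfolding i using nth by (auto simp: set_conv_nth)
    then show ?thesis using q i nth Cons.hyps(3) by (intro exI[of _ q]) (auto simp: nth_append)
  qed
qed

section \<open>Trees on an initial segment of the naturals, given by parent functions\<close>

definition parent_tree :: "nat \<Rightarrow> (nat \<Rightarrow> nat) \<Rightarrow> nat pair_pre_digraph" where
  "parent_tree n par = \<lparr>pverts = {..<n},
     parcs = {(i, par i) | i. 0 < i \<and> i < n} \<union> {(par i, i) | i. 0 < i \<and> i < n}\<rparr>"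

text \<open>The least element of \<open>Q\<close> is the root of the subtree. The least element of a
  closed set must be this root, since otherwise its parent would be a smaller one; from the root,
  induction reaches all of \<open>Q\<close>.\<close>

lemma conn_parents:
  fixes Q :: "nat set"
  assumes "Q \<noteq> {}"
    and "\<And>q. \<lbrakk>q \<in> Q; q \<noteq> (LEAST q. q \<in> Q)\<rbrakk> \<Longrightarrow> par q \<in> Q \<and> par q < q \<and> (q, par q) \<in> E \<and> (par q, q) \<in> E"
  shows "conn E Q"
proof (rule connI)
  fix D assume D: "D \<inter> Q \<noteq> {}" "\<And>u v. \<lbrakk>u \<in> D; u \<in> Q; v \<in> Q; (u, v) \<in> E\<rbrakk> \<Longrightarrow> v \<in> D"
  let ?m = "LEAST q. q \<in> Q" and ?d = "LEAST q. q \<in> D \<inter> Q"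
  have d: "?d \<in> D \<inter> Q" using D(1) LeastI_ex[of "\<lambda>q. q \<in> D \<inter> Q"] by blast
  have m: "?m \<in> D"
  proof (rule ccontr)
    assume "?m \<notin> D"
    then have "?d \<noteq> ?m" using d by auto
    then have p: "par ?d \<in> Q" "par ?d < ?d" "(?d, par ?d) \<in> E" using assms(2)[of ?d] d by auto
    then have "par ?d \<in> D \<inter> Q" using D(2)[of ?d "par ?d"] d by blast
    then show False using p(2) not_less_Least[of "par ?d" "\<lambda>q. q \<in> D \<inter> Q"] by blast
  qed
  show "Q \<subseteq> D"
  proof
    fix q assume "q \<in> Q"
    then show "q \<in> D"
    proof (induction q rule: less_induct)
      case (less q)
      show ?case
      proof (cases "q = ?m")
        case False
        then have "par q \<in> Q" "par q < q" "(par q, q) \<in> E" using assms(2)[of q] less.prems by auto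
        then show ?thesis using less D(2)[of "par q" q] by blast
      qed (use m in simp)
    qed
  qed
qed (rule assms(1))

lemma pcas_nth:
  assumes "pcas u p v" "p \<noteq> []"
  shows "fst (p ! 0) = u \<and> snd (last p) = v \<and> (\<forall>i. Suc i < length p \<longrightarrow> fst (p ! Suc i) = snd (p ! i))"
  using assms
proof (induction p arbitrary: u)
  case (Cons e es)
  show ?case
  proof (cases "es = []")
    case False
    then have IH: "fst (es ! 0) = snd e" "snd (last es) = v"
      "\<And>i. Suc i < length es \<Longrightarrow> fst (es ! Suc i) = snd (es ! i)"
      using Cons by auto
    have "fst ((e # es) ! Suc i) = snd ((e # es) ! i)" if "Suc i < length (e # es)" for i
      using IH that by (cases i) auto
    then show ?thesis using Cons.prems IH False by simp
  qed (use Cons in simp)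
qed simp

text \<open>At the largest node of a cycle both cycle neighbours would be its parent.\<close>

lemma parent_tree_acyclic:
  assumes par: "\<And>i. \<lbrakk>0 < i; i < n\<rbrakk> \<Longrightarrow> par i < i"
    and cyc: "pre_digraph.cycle (with_proj (parent_tree n par)) p"
  shows "length p < 3"
proof (rule ccontr)
  assume "\<not> length p < 3"
  define l where "l = length p"
  then have l: "l \<ge> 3" using \<open>\<not> length p < 3\<close> by simp
  obtain u where u: "pcas u p u" "set p \<subseteq> parcs (parent_tree n par)" "distinct (tl (pawalk_verts u p))"
    using cyc unfolding pre_digraph.cycle_def pre_digraph.awalk_def
    by (auto simp: cas_with_proj_eq awalk_verts_with_proj_eq)
  have pne: "p \<noteq> []" using l l_def by auto
  \<comment> \<open>Heads of the arcs, read cyclically, so that every index has a predecessor and a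
    successor.\<close>
  define w where "w i = snd (p ! (i mod l))" for i
  have "tl (pawalk_verts u p) = map snd p"
  proof -
    have "pawalk_verts u' q = fst (hd q) # map snd q" if "pcas u' q v" "q \<noteq> []" for u' q v
      using that
    proof (induction q arbitrary: u')
      case (Cons e q)
      then show ?case by (cases q) auto
    qed simp
    then show ?thesis using u(1) pne by fastforce
  qed
  then have dist: "distinct (map snd p)" using u(3) by simp
  have inj: "w i = w j \<longleftrightarrow> i mod l = j mod l" for i j
  proof -
    have "i mod l < length p" "j mod l < length p" unfolding l_def using pne by simp_all
    then show ?thesis
      unfolding w_def using nth_eq_iff_index_eq[OF dist, of "i mod l" "j mod l"] by simp
  qed
  have arc: "(w i, w (Suc i)) \<in> parcs (parent_tree n par)" for i
  proof -
    let ?j = "Suc i mod l"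
    have j: "?j < length p" unfolding l_def using pne by simp
    have "fst (p ! ?j) = w i"
    proof (cases "?j")
      case 0
      then have "i mod l = l - 1" using l by (simp add: mod_Suc split: if_splits)
      then show ?thesis
        using 0 pcas_nth[OF u(1) pne] pne by (simp add: w_def last_conv_nth l_def)
    next
      case (Suc k)
      then have "i mod l = k" using l by (simp add: mod_Suc split: if_splits)
      then show ?thesis using Suc pcas_nth[OF u(1) pne] j by (simp add: w_def)
    qed
    moreover have "p ! ?j \<in> parcs (parent_tree n par)" using u(2) j nth_mem by blast
    ultimately show ?thesis unfolding w_def by (metis prod.collapse)
  qed
  have arcD: "b = par a \<and> b < a \<or> a = par b \<and> a < b" if "(a, b) \<in> parcs (parent_tree n par)" for a b
    using that par by (auto simp: parent_tree_def)
  have "finite (range w)"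
  proof (rule finite_subset)
    show "range w \<subseteq> w ` {..<l}"
    proof
      fix x assume "x \<in> range w"
      then obtain i where "x = w i" by blast
      then have "x = w (i mod l)" using inj by simp
      then show "x \<in> w ` {..<l}" using l by simp
    qed
  qed simp
  then have "Max (range w) \<in> range w" by (intro Max_in) auto
  then obtain i where i: "w i = Max (range w)" by force
  have mx: "w j \<le> w i" for j unfolding i by (rule Max_ge) (use \<open>finite (range w)\<close> in auto)
  \<comment> \<open>The index before \<open>i\<close> modulo \<open>l\<close>, shifted by
    \<open>l\<close> to stay in the naturals. If both neighbours of the maximum are its parent,
    \<open>j\<close> and \<open>i + 1\<close> are congruent and \<open>l\<close> divides 2.\<close>
  define j where "j = i + l - 1"
  have "w (Suc j) = w i" unfolding inj using l by (simp add: j_def)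
  then have "w j = par (w i)" using arcD[OF arc[of j]] mx[of j] by auto
  moreover have "w (Suc i) = par (w i)" using arcD[OF arc[of i]] mx[of "Suc i"] by auto
  ultimately have "w j = w (Suc i)" by simp
  then have "j mod l = Suc i mod l" unfolding inj .
  then have "(j + 2) mod l = (Suc i + 2) mod l" by (metis mod_add_left_eq)
  moreover have "j + 2 = Suc i + l" using l by (simp add: j_def)
  then have "(j + 2) mod l = Suc i mod l" by (metis mod_add_self2)
  ultimately have "(Suc i + 2) mod l = Suc i mod l" by simp
  then have "l dvd 2" by (simp add: mod_eq_dvd_iff_nat)
  then show False using l by (auto dest: dvd_imp_le)
qed

lemma undirected_tree_parent_tree:
  assumes "n > 0" and par: "\<And>i. \<lbrakk>0 < i; i < n\<rbrakk> \<Longrightarrow> par i < i"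
  shows "undirected_tree (parent_tree n par)"
proof -
  let ?T = "parent_tree n par"
  have "par i < n" if "0 < i" "i < n" for i using par[OF that] that(2) by simp
  then have sub: "parcs ?T \<subseteq> {..<n} \<times> {..<n}"
    by (auto simp: parent_tree_def)
  have "pair_graph ?T"
  proof
    show "finite (parcs ?T)" using sub finite_subset by blast
    show "symmetric (with_proj ?T)" by (auto simp: symmetric_def parent_tree_def intro!: symI)
    show "fst e \<noteq> snd e" if "e \<in> parcs ?T" for e
      using that par[THEN less_imp_neq] par[THEN less_imp_neq, symmetric] by (auto simp: parent_tree_def)
  qed (use sub in \<open>auto simp: parent_tree_def\<close>)
  moreover have "conn (parcs ?T) {..<n}"
  proof (rule conn_parents[where par = par])
    fix q assume q: "q \<in> {..<n}" "q \<noteq> (LEAST q. q \<in> {..<n})"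
    have "(LEAST q. q \<in> {..<n}) = 0" using assms(1) by (intro Least_equality) auto
    then have "0 < q" using q(2) by simp
    then show "par q \<in> {..<n} \<and> par q < q \<and> (q, par q) \<in> parcs ?T \<and> (par q, q) \<in> parcs ?T"
      using par[of q] q(1) by (auto simp: parent_tree_def)
  qed (use assms(1) in auto)
  then have "Digraph_Component.connected (with_proj ?T \<restriction> {..<n})"
    by (intro connected_induce_subgraph) (simp add: parent_tree_def)
  moreover have "with_proj ?T \<restriction> {..<n} = with_proj ?T"
    using sub by (auto simp: induce_subgraph_def with_proj_def parent_tree_def)
  ultimately show ?thesis
    unfolding undirected_tree_def using parent_tree_acyclic[OF par] by fastforce
qed

text \<open>The nodes whose bags contain \<open>v\<close> form a subtree: any such node except the
  least shares \<open>v\<close> with an earlier bag, hence by the running intersection property with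
  its parent.\<close>

lemma treewidth_le_rip:
  assumes "pair_graph G" "rip bs" "\<Union>(set bs) = pverts G"
    and edges: "\<And>u v. (u, v) \<in> parcs G \<Longrightarrow> \<exists>b\<in>set bs. u \<in> b \<and> v \<in> b"
    and card: "\<And>b. b \<in> set bs \<Longrightarrow> card b \<le> w"
  shows "treewidth G \<le> int w - 1"
proof -
  define n where "n = length bs"
  define bag where "bag i = rev bs ! i" for i
  have n: "n > 0" using rip_nonempty[OF assms(2)] by (simp add: n_def)
  have "\<forall>i. \<exists>p. 0 < i \<and> i < n \<longrightarrow> p < i \<and> bag i \<inter> (\<Union>j<i. bag j) \<subseteq> bag p"
    using rip_parent[OF assms(2)] unfolding bag_def n_def by metis
  from choice[OF this] obtain par
    where par: "\<And>i. \<lbrakk>0 < i; i < n\<rbrakk> \<Longrightarrow> par i < i \<and> bag i \<inter> (\<Union>j<i. bag j) \<subseteq> bag (par i)" by blast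
  let ?T = "parent_tree n par"
  have V: "pverts ?T = {..<n}" by (simp add: parent_tree_def)
  have bags: "set bs = bag ` {..<n}"
    unfolding bag_def n_def set_rev[of bs, symmetric] by (auto simp: set_conv_nth simp del: set_rev)
  have "Digraph_Component.connected (with_proj ?T \<restriction> {t \<in> pverts ?T. v \<in> bag t})"
    if "v \<in> pverts G" for v
  proof (rule connected_induce_subgraph)
    let ?Q = "{t \<in> pverts ?T. v \<in> bag t}"
    have "v \<in> \<Union>(bag ` {..<n})" using that assms(3) bags by simp
    then have ne: "?Q \<noteq> {}" using V by auto
    show "conn (parcs ?T) ?Q"
    proof (rule conn_parents[where par = par, OF ne])
      fix q assume q: "q \<in> ?Q" "q \<noteq> (LEAST q. q \<in> ?Q)"
      let ?m = "LEAST q. q \<in> ?Q"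
      have m: "?m \<in> ?Q" using ne LeastI_ex[of "\<lambda>q. q \<in> ?Q"] by blast
      have lt: "?m < q" using q Least_le[of "\<lambda>q. q \<in> ?Q" q] by linarith
      have qn: "0 < q" "q < n" using lt q(1) V by auto
      have "v \<in> bag q \<inter> (\<Union>j<q. bag j)" using q(1) m lt by blast
      then have "v \<in> bag (par q)" "par q < q" using par[OF qn] by blast+
      then show "par q \<in> ?Q \<and> par q < q \<and> (q, par q) \<in> parcs ?T \<and> (par q, q) \<in> parcs ?T"
        using qn V by (auto simp: parent_tree_def)
    qed
  qed auto
  moreover have "undirected_tree ?T" by (rule undirected_tree_parent_tree[OF n]) (use par in blast)
  ultimately have td: "tree_decomposition G ?T bag"
    unfolding tree_decomposition_def using V bags assms(3) edges by auto
  have "Max ((\<lambda>t. card (bag t)) ` pverts ?T) \<le> w"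
    using V n card bags by (intro Max.boundedI) auto
  then have "decomposition_width ?T bag \<le> int w - 1"
    unfolding decomposition_width_def by simp
  then show ?thesis using treewidth_le[OF assms(1) td] by linarith
qed

section \<open>Splitting connected graphs of maximum degree three\<close>

text \<open>The removed component is joined to the rest of \<open>S\<close> only through
  \<open>s\<close>. Hence a closed set containing \<open>s\<close> stays closed when the component
  is added, and one missing \<open>s\<close> stays closed when it is taken away.\<close>

lemma conn_remove_component:
  assumes "sym F" "conn F S" "s \<in> S" "y \<in> S - {s}"
  shows "conn F (S - component F (S - {s}) y)"
proof (rule connI)
  let ?K = "component F (S - {s}) y"
  have K: "?K \<subseteq> S - {s}" by (rule component_subset)
  then show "S - ?K \<noteq> {}" using assms(3) by blast
  fix D assume D: "D \<inter> (S - ?K) \<noteq> {}"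
    "\<And>u v. \<lbrakk>u \<in> D; u \<in> S - ?K; v \<in> S - ?K; (u, v) \<in> F\<rbrakk> \<Longrightarrow> v \<in> D"
  have out: "v = s" if "(u, v) \<in> F" "u \<in> ?K" "v \<in> S - ?K" for u v
    using component_step[OF assms(1,4) that(2) _ that(1)] that(3) by blast
  show "S - ?K \<subseteq> D"
  proof (cases "s \<in> D")
    case True
    have "S \<subseteq> D \<union> ?K"
    proof (rule conn_closed[OF assms(2)])
      fix u v assume uv: "u \<in> D \<union> ?K" "u \<in> S" "v \<in> S" "(u, v) \<in> F"
      then show "v \<in> D \<union> ?K" using out[OF uv(4)] D(2)[OF _ _ _ uv(4)] True by blast
    qed (use D(1) in blast)
    then show ?thesis by blast
  next
    case False
    have "S \<subseteq> D - ?K"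
    proof (rule conn_closed[OF assms(2)])
      fix u v assume uv: "u \<in> D - ?K" "u \<in> S" "v \<in> S" "(u, v) \<in> F"
      have "v \<notin> ?K" using out[of v u] uv symD[OF assms(1) uv(4)] False by blast
      then show "v \<in> D - ?K" using D(2)[OF _ _ _ uv(4)] uv by blast
    qed (use D(1) in blast)
    then show ?thesis by blast
  qed
qed

text \<open>Every component of \<open>S - {s}\<close> contains a neighbour of \<open>s\<close>, so
  there are at most \<open>d\<close> of them. The extra 1 is for \<open>s\<close> itself.\<close>

lemma card_components_le:
  assumes "sym F" "finite S" "conn F S" "s \<in> S" "card (F `` {s} \<inter> (S - {s})) \<le> d"
    and "\<And>y. y \<in> S - {s} \<Longrightarrow> card (component F (S - {s}) y \<inter> W) \<le> m"
  shows "card (S \<inter> W) \<le> Suc (d * m)"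
proof -
  let ?N = "F `` {s} \<inter> (S - {s})" and ?K = "component F (S - {s})"
  have fin: "finite ?N" "finite (S \<inter> W)" using assms(2) by auto
  have sub: "S \<subseteq> {s} \<union> (\<Union>y\<in>?N. ?K y)"
  proof (rule conn_closed[OF assms(3)])
    fix u v assume uv: "u \<in> {s} \<union> (\<Union>y\<in>?N. ?K y)" "u \<in> S" "v \<in> S" "(u, v) \<in> F"
    show "v \<in> {s} \<union> (\<Union>y\<in>?N. ?K y)"
    proof (cases "u = s \<or> v = s")
      case True
      then show ?thesis using uv component_self[of v "S - {s}" F] by blast
    next
      case False
      then obtain y where y: "y \<in> ?N" "u \<in> ?K y" using uv(1) by blast
      then have "v \<in> ?K y" using component_step[OF assms(1) _ y(2) _ uv(4)] uv(3) False by blast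
      then show ?thesis using y by blast
    qed
  qed (use assms(4) in blast)
  have "finite (?K y)" for y
    using component_subset[of F "S - {s}" y] assms(2) by (metis finite_Diff finite_subset)
  then have "finite ({s} \<union> (\<Union>y\<in>?N. ?K y \<inter> W))" using fin(1) by simp
  then have "card (S \<inter> W) \<le> card ({s} \<union> (\<Union>y\<in>?N. ?K y \<inter> W))"
    by (rule card_mono) (use sub in blast)
  also have "\<dots> \<le> 1 + card (\<Union>y\<in>?N. ?K y \<inter> W)"
    using card_Un_le[of "{s}"] by (metis One_nat_def card.empty card_insert_disjoint empty_iff finite.emptyI)
  also have "card (\<Union>y\<in>?N. ?K y \<inter> W) \<le> (\<Sum>y\<in>?N. card (?K y \<inter> W))"
    by (rule card_UN_le[OF fin(1)])
  also have "\<dots> \<le> card ?N * m" using sum_bounded_above[of ?N "\<lambda>y. card (?K y \<inter> W)" m] assms(6) by simp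
  also have "\<dots> \<le> d * m" using assms(5) by simp
  finally show ?thesis by simp
qed

text \<open>Take \<open>S\<close> of least size among the connected sets with connected or empty
  rest and at least \<open>m\<close> marks. If \<open>s\<close> in \<open>S\<close> has a neighbour
  outside, each component of \<open>S - {s}\<close> is smaller with connected rest, so it has at
  most \<open>m - 1\<close> marks; and \<open>s\<close> has at most two neighbours inside. This
  gives \<open>2 * (m - 1) + 1\<close> marks, and it is the place where degree three is used. The
  case \<open>S = N\<close> would allow only \<open>3 * (m - 1) + 1\<close> marks in all.\<close>

lemma conn_peel:
  assumes "sym F" "finite N" "conn F N" "\<And>x. x \<in> N \<Longrightarrow> card (F `` {x} \<inter> N) \<le> 3"
    and "m > 0" "3 * m - 1 \<le> card (N \<inter> W)"
  obtains S where "S \<subseteq> N" "conn F S" "conn F (N - S)" "m \<le> card (S \<inter> W)" "card (S \<inter> W) \<le> 2 * m - 1"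
proof -
  let ?ok = "\<lambda>S. S \<subseteq> N \<and> conn F S \<and> (S = N \<or> conn F (N - S)) \<and> m \<le> card (S \<inter> W)"
  have "\<exists>S. ?ok S \<and> (\<forall>S'. ?ok S' \<longrightarrow> card S \<le> card S')"
    by (rule ex_has_least_nat[of ?ok N]) (use assms in auto)
  then obtain S where ok: "?ok S" and least: "\<forall>S'. ?ok S' \<longrightarrow> card S \<le> card S'"
    by (elim exE conjE) (rule that, auto)
  have fin: "finite S" using ok assms(2) finite_subset by blast
  have small: "card (component F (S - {s}) y \<inter> W) \<le> m - 1"
    if s: "s \<in> S" "S = N \<or> (\<exists>v\<in>N - S. (s, v) \<in> F)" and y: "y \<in> S - {s}" for s y
  proof (rule ccontr)
    let ?K = "component F (S - {s}) y"
    assume "\<not> card (?K \<inter> W) \<le> m - 1"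
    moreover have K: "?K \<subseteq> S - {s}" by (rule component_subset)
    moreover have SK: "conn F (S - ?K)" using ok conn_remove_component[OF assms(1) _ s(1) y] by blast
    have "conn F (N - ?K)"
    proof (cases "S = N")
      case False
      then have "conn F ((S - ?K) \<union> (N - S))"
        using conn_Un[OF assms(1) SK, of "N - S"] ok s K by blast
      moreover have "(S - ?K) \<union> (N - S) = N - ?K" using ok K by blast
      ultimately show ?thesis by simp
    qed (use SK in simp)
    ultimately have "?ok ?K" using ok conn_component[OF y, of F] by auto
    then have "card S \<le> card ?K" using least by blast
    moreover have "card ?K < card S" using K s(1) by (intro psubset_card_mono[OF fin]) blast
    ultimately show False by simp
  qed
  have "S \<noteq> N"
  proof
    assume eq: "S = N"
    obtain s where s: "s \<in> N" using conn_nonempty[OF assms(3)] by blast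
    have "card (F `` {s} \<inter> (N - {s})) \<le> card (F `` {s} \<inter> N)"
      by (rule card_mono) (use assms(2) in auto)
    then have "card (N \<inter> W) \<le> Suc (3 * (m - 1))"
      using small[of s] s eq assms(4)[OF s]
      by (intro card_components_le[OF assms(1-3) s]) auto
    then show False using assms(5,6) by linarith
  qed
  then have ne: "N - S \<noteq> {}" "conn F (N - S)" using ok by auto
  have "S \<inter> N \<noteq> {}" "\<not> N \<subseteq> S" using ok conn_nonempty[of F S] ne by auto
  then obtain s v where sv: "s \<in> S" "v \<in> N" "v \<notin> S" "(s, v) \<in> F"
    by (rule conn_crossing[OF assms(3)])
  have "F `` {s} \<inter> (S - {s}) \<subset> F `` {s} \<inter> N" using sv ok by blast
  then have "card (F `` {s} \<inter> (S - {s})) < card (F `` {s} \<inter> N)"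
    by (intro psubset_card_mono) (use assms(2) in auto)
  moreover have "card (F `` {s} \<inter> N) \<le> 3" using assms(4) sv(1) ok by blast
  ultimately have "card (S \<inter> W) \<le> Suc (2 * (m - 1))"
    using small[OF sv(1)] sv ok by (intro card_components_le[OF assms(1) fin _ sv(1)]) auto
  then have "card (S \<inter> W) \<le> 2 * m - 1" using assms(5) by simp
  then show ?thesis using that ok ne by blast
qed

text \<open>Peel \<open>n\<close> times, at a cost of at most \<open>2 * m - 1\<close> marks each;
  the rest still has \<open>m\<close> marks and is the piece number \<open>n + 1\<close>. Before
  each peeling at least \<open>(2 * m - 1) + m = 3 * m - 1\<close> marks are present.\<close>

lemma conn_split:
  assumes "sym F" "finite N" "conn F N" "\<And>x. x \<in> N \<Longrightarrow> card (F `` {x} \<inter> N) \<le> 3"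
    and "m > 0" "n * (2 * m - 1) + m \<le> card (N \<inter> W)"
  shows "\<exists>T. (\<forall>i\<le>n. T i \<subseteq> N \<and> conn F (T i) \<and> m \<le> card (T i \<inter> W)) \<and> disjoint_family_on T {..n}"
  using assms(2-4,6)
proof (induction n arbitrary: N)
  case 0
  then show ?case by (intro exI[of _ "\<lambda>_. N"]) (auto simp: disjoint_family_on_def)
next
  case (Suc n)
  have "3 * m - 1 \<le> card (N \<inter> W)" using Suc.prems(4) assms(5) by simp
  then obtain S where S: "S \<subseteq> N" "conn F S" "conn F (N - S)" "m \<le> card (S \<inter> W)"
    "card (S \<inter> W) \<le> 2 * m - 1"
    using conn_peel[OF assms(1) Suc.prems(1,2) _ assms(5), of W] Suc.prems(3) by blast
  have "card (N \<inter> W) \<le> card ((N - S) \<inter> W) + card (S \<inter> W)"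
    by (rule order.trans[OF card_mono card_Un_le]) (use Suc.prems(1) S(1) finite_subset in auto)
  then have "n * (2 * m - 1) + m \<le> card ((N - S) \<inter> W)" using Suc.prems(4) S(5) by simp
  moreover have "card (F `` {x} \<inter> (N - S)) \<le> 3" if "x \<in> N - S" for x
  proof -
    have "card (F `` {x} \<inter> (N - S)) \<le> card (F `` {x} \<inter> N)"
      by (rule card_mono) (use Suc.prems(1) in auto)
    also have "\<dots> \<le> 3" using Suc.prems(3) that by simp
    finally show ?thesis .
  qed
  ultimately obtain T where T: "\<And>i. i \<le> n \<Longrightarrow> T i \<subseteq> N - S \<and> conn F (T i) \<and> m \<le> card (T i \<inter> W)"
    "disjoint_family_on T {..n}"
    using Suc.IH[OF _ S(3)] Suc.prems(1) by auto
  let ?T = "T(Suc n := S)"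
  have "?T i \<subseteq> N \<and> conn F (?T i) \<and> m \<le> card (?T i \<inter> W)" if "i \<le> Suc n" for i
    using that T(1)[of i] S by (cases "i = Suc n") auto
  moreover have "disjoint_family_on ?T {..Suc n}"
    unfolding disjoint_family_on_def
  proof (intro ballI impI)
    fix i j assume ij: "i \<in> {..Suc n}" "j \<in> {..Suc n}" "i \<noteq> j"
    show "?T i \<inter> ?T j = {}"
    proof (cases "i \<le> n \<and> j \<le> n")
      case True
      then show ?thesis using T(2) ij(3) by (auto simp: disjoint_family_on_def)
    next
      case False
      then show ?thesis using T(1)[of i] T(1)[of j] ij by (auto simp: le_Suc_eq)
    qed
  qed
  ultimately show ?case by blast
qed

section \<open>Packing copies along a linkage\<close>

text \<open>
  Greedily: \<open>j\<close> chosen pairs use up at most \<open>2jm\<close> links, and if all remaining \<open>(a - j)\<^sup>2\<close> pairs were light,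
  they would carry at most \<open>r - 1\<close> links each.
\<close>

lemma heavy_matching:
  fixes f g :: "'l \<Rightarrow> nat"
  assumes "finite L" "card L = a * m"
    and fg: "\<And>l. l \<in> L \<Longrightarrow> f l < a \<and> g l < a"
    and fibre: "\<And>i. card {l \<in> L. f l = i} \<le> m" "\<And>i. card {l \<in> L. g l = i} \<le> m"
    and count: "\<And>j. j < k \<Longrightarrow> 2 * j * m + (a - j)\<^sup>2 * (r - 1) < a * m"
  shows "\<exists>p q. inj_on p {..<k} \<and> inj_on q {..<k} \<and>
    (\<forall>t<k. p t < a \<and> q t < a \<and> r \<le> card {l \<in> L. f l = p t \<and> g l = q t})"
  using count
proof (induction k)
  case (Suc k)
  have "\<exists>p q. inj_on p {..<k} \<and> inj_on q {..<k} \<and>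
      (\<forall>t<k. p t < a \<and> q t < a \<and> r \<le> card {l \<in> L. f l = p t \<and> g l = q t})"
    by (rule Suc.IH) (use Suc.prems in simp)
  then obtain p q where pq: "inj_on p {..<k}" "inj_on q {..<k}"
    "\<And>t. t < k \<Longrightarrow> p t < a \<and> q t < a \<and> r \<le> card {l \<in> L. f l = p t \<and> g l = q t}"
    by blast
  define A where "A = {..<a} - p ` {..<k}"
  define B where "B = {..<a} - q ` {..<k}"
  have AB: "card A = a - k" "card B = a - k"
    unfolding A_def B_def using pq
    by (subst card_Diff_subset; force simp: card_image)+
  have fin: "finite A" "finite B" by (simp_all add: A_def B_def)
  have "\<exists>x\<in>A. \<exists>y\<in>B. r \<le> card {l \<in> L. f l = x \<and> g l = y}"
  proof (rule ccontr)
    assume "\<not> ?thesis"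
    then have light: "card {l \<in> L. f l = x \<and> g l = y} \<le> r - 1" if "x \<in> A" "y \<in> B" for x y
      using that by fastforce
    let ?P = "\<Union>i\<in>p ` {..<k}. {l \<in> L. f l = i}" and ?Q = "\<Union>i\<in>q ` {..<k}. {l \<in> L. g l = i}"
      and ?R = "\<Union>z\<in>A \<times> B. {l \<in> L. f l = fst z \<and> g l = snd z}"
    have "card ?P \<le> (\<Sum>i\<in>p ` {..<k}. card {l \<in> L. f l = i})" by (rule card_UN_le) simp
    also have "\<dots> \<le> card (p ` {..<k}) * m"
      using sum_bounded_above[of "p ` {..<k}" "\<lambda>i. card {l \<in> L. f l = i}" m] fibre by simp
    finally have P: "card ?P \<le> k * m" using pq(1) by (simp add: card_image)
    have "card ?Q \<le> (\<Sum>i\<in>q ` {..<k}. card {l \<in> L. g l = i})" by (rule card_UN_le) simp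
    also have "\<dots> \<le> card (q ` {..<k}) * m"
      using sum_bounded_above[of "q ` {..<k}" "\<lambda>i. card {l \<in> L. g l = i}" m] fibre by simp
    finally have Q: "card ?Q \<le> k * m" using pq(2) by (simp add: card_image)
    have "card ?R \<le> (\<Sum>z\<in>A \<times> B. card {l \<in> L. f l = fst z \<and> g l = snd z})"
      by (rule card_UN_le) (use fin in simp)
    also have "\<dots> \<le> card (A \<times> B) * (r - 1)"
      using sum_bounded_above[of "A \<times> B" "\<lambda>z. card {l \<in> L. f l = fst z \<and> g l = snd z}" "r - 1"] light
      by auto
    finally have R: "card ?R \<le> (a - k)\<^sup>2 * (r - 1)" using AB by (simp add: power2_eq_square card_cartesian_product)
    have "L \<subseteq> ?P \<union> ?Q \<union> ?R" using fg by (auto simp: A_def B_def)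
    then have "card L \<le> card (?P \<union> ?Q \<union> ?R)"
      by (rule card_mono[rotated]) (use assms(1) fin in auto)
    also have "\<dots> \<le> card ?P + card ?Q + card ?R"
      using card_Un_le[of ?P ?Q] card_Un_le[of "?P \<union> ?Q" ?R] by linarith
    also have "\<dots> \<le> 2 * k * m + (a - k)\<^sup>2 * (r - 1)" using P Q R by simp
    also have "\<dots> < a * m" using Suc.prems by simp
    finally show False using assms(2) by simp
  qed
  then obtain x y where xy: "x \<in> A" "y \<in> B" "r \<le> card {l \<in> L. f l = x \<and> g l = y}" by blast
  have "inj_on (p(k := x)) {..<Suc k}" "inj_on (q(k := y)) {..<Suc k}"
    using pq(1,2) xy(1,2) by (auto simp: A_def B_def inj_on_def less_Suc_eq)
  moreover have "\<forall>t<Suc k. (p(k := x)) t < a \<and> (q(k := y)) t < a \<and>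
      r \<le> card {l \<in> L. f l = (p(k := x)) t \<and> g l = (q(k := y)) t}"
    using pq(3) xy by (auto simp: A_def B_def less_Suc_eq)
  ultimately show ?case by blast
qed simp

text \<open>
  Links between attachment vertices of \<open>C\<close> use only arcs that touch \<open>C\<close>, so that each of them has an
  inner vertex in \<open>C\<close>, which becomes a branch set of the minor.
\<close>

definition touching :: "'a set \<Rightarrow> 'a rel \<Rightarrow> 'a rel" where
  "touching C E = {(u, v) \<in> E. u \<in> C \<or> v \<in> C}"

lemma sym_touching: "sym E \<Longrightarrow> sym (touching C E)"
  by (auto simp: touching_def sym_def)

lemma touching_subset: "touching C E \<subseteq> E"
  by (auto simp: touching_def)

text \<open>Trim \<open>P\<close> to a set with ends \<open>y\<close> and \<open>z\<close> either of
  which can be removed. Both ends lie outside \<open>C\<close>, so no arc of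
  \<open>touching C E\<close> joins them and the interior is not empty. One component of the
  interior is adjacent to both ends.\<close>

lemma link_interior:
  assumes "sym E" "finite P" "conn (touching C E) P" "P \<subseteq> C \<union> Y \<union> Z"
    and "P \<inter> Y = {y}" "P \<inter> Z = {z}" "y \<noteq> z" "C \<inter> (Y \<union> Z) = {}"
  obtains Q where "Q \<subseteq> P \<inter> C" "conn E Q" "\<exists>u\<in>Q. (y, u) \<in> E" "\<exists>u\<in>Q. (z, u) \<in> E"
proof -
  let ?E = "touching C E"
  have s: "sym ?E" using assms(1) by (rule sym_touching)
  have yz: "y \<in> P" "z \<in> P" "y \<notin> C" "z \<notin> C" using assms(5,6,8) by auto
  have "P \<inter> {y} \<noteq> {}" "z \<notin> {y}" using yz(1) assms(7) by auto
  then obtain P' y' where "P' \<subseteq> P" "P' \<inter> {y} = {y'}" "z \<in> P'" "conn ?E P'"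
    "conn ?E (P' - {y'})" "conn ?E (P' - {z})"
    using conn_between[OF s assms(2,3) _ yz(2), of "{y}"] by blast
  moreover from this have "y' = y" "y \<in> P'" by auto
  ultimately have P': "P' \<subseteq> P" "y \<in> P'" "z \<in> P'" "conn ?E P'" "conn ?E (P' - {y})" "conn ?E (P' - {z})"
    by simp_all
  let ?I = "P' - {y, z}"
  have IC: "?I \<subseteq> P \<inter> C" using P'(1) assms(4,5,6) by blast
  have "{y} \<inter> P' \<noteq> {}" "\<not> P' \<subseteq> {y}" using P' assms(7) by auto
  then obtain u v where "u \<in> {y}" "v \<in> P'" "v \<notin> {y}" "(u, v) \<in> ?E"
    by (rule conn_crossing[OF P'(4)])
  then have x: "v \<in> ?I" using yz by (auto simp: touching_def)
  let ?Q = "component ?E ?I v"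
  have Q: "?Q \<subseteq> ?I" "v \<in> ?Q" "conn ?E ?Q"
    using component_subset[of ?E ?I v] component_self[OF x] conn_component[OF x] by simp_all
  \<comment> \<open>With \<open>b\<close> removed the trimmed set is still connected, so there is a
    way out of the component, and \<open>a\<close> is the only vertex it can lead to.\<close>
  have adj: "\<exists>u\<in>?Q. (a, u) \<in> E" if ab: "{a, b} = {y, z}" "a \<noteq> b" for a b
  proof -
    have ab': "a \<in> P'" "b \<in> P'" "conn ?E (P' - {b})" "?I = P' - {b} - {a}"
      using ab P' by (auto simp: doubleton_eq_iff)
    have "?Q \<inter> (P' - {b}) \<noteq> {}" "\<not> P' - {b} \<subseteq> ?Q" using Q(1,2) ab' ab(2) by blast+
    then obtain u w where uw: "u \<in> ?Q" "w \<in> P' - {b}" "w \<notin> ?Q" "(u, w) \<in> ?E"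
      by (rule conn_crossing[OF ab'(3)])
    then have "w = a" using component_step[OF s x uw(1) _ uw(4)] ab'(4) by blast
    then show ?thesis using uw symD[OF assms(1)] touching_subset[of C E] by blast
  qed
  have "conn E ?Q" using conn_mono[OF Q(3) touching_subset] .
  then show ?thesis using that[of ?Q] adj[of y z] adj[of z y] Q(1) IC assms(7) by blast
qed

text \<open>A heavy pair consists of a piece \<open>T i\<close> from the first half and a piece
  \<open>T (a + j)\<close> from the second. These are the branch sets for the part of size 2; the
  interiors of \<open>r\<close> links between them are those for the other part.\<close>

lemma minor_of_linkage:
  fixes G :: "'a pair_pre_digraph"
  assumes G: "pair_graph G" and "r > 0"
    and C: "C \<subseteq> pverts G"
    and T: "\<And>i. i < 2 * a \<Longrightarrow> T i \<subseteq> pverts G" "\<And>i. i < 2 * a \<Longrightarrow> conn (parcs G) (T i)"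
      "\<And>i. i < 2 * a \<Longrightarrow> T i \<inter> C = {}" "disjoint_family_on T {..<2 * a}"
    and W: "\<And>i. i < 2 * a \<Longrightarrow> W i \<subseteq> T i" "\<And>i. i < 2 * a \<Longrightarrow> card (W i) = m"
    and Y: "Y = (\<Union>i<a. W i)" and Z: "Z = (\<Union>i<a. W (a + i))"
    and L: "linkage (touching C (parcs G)) (C \<union> Y \<union> Z) Y Z \<P>" "card \<P> = a * m"
    and count: "\<And>j. j < k \<Longrightarrow> 2 * j * m + (a - j)\<^sup>2 * (r - 1) < a * m"
  shows "minor_of (disjoint_copies k (complete_bipartite 2 r)) G"
proof -
  interpret G: pair_graph G by (rule G)
  let ?E = "parcs G"
  have symE: "sym ?E" using G.pair_sym_arcs by (simp add: symmetric_def)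
  have finV: "finite (pverts G)" by (rule G.pair_finite_verts)
  note P = linkageD[OF L(1)]
  have Wdisj: "W i \<inter> W j = {}" if "i < 2 * a" "j < 2 * a" "i \<noteq> j" for i j
    using T(4) W(1)[OF that(1)] W(1)[OF that(2)] that by (fastforce simp: disjoint_family_on_def)
  have finW: "finite (W i)" if "i < 2 * a" for i
    using W(1)[OF that] T(1)[OF that] finV by (meson finite_subset)
  have WC: "W i \<inter> C = {}" if "i < 2 * a" for i using W(1)[OF that] T(3)[OF that] by blast
  have "W i \<inter> C = {}" "W (a + i) \<inter> C = {}" if "i < a" for i
    using WC[of i] WC[of "a + i"] that by simp_all
  then have YC: "C \<inter> (Y \<union> Z) = {}" unfolding Y Z by blast
  have "W i \<inter> W (a + j) = {}" if "i < a" "j < a" for i j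
    using Wdisj[of i "a + j"] that by simp
  then have YZ: "Y \<inter> Z = {}" unfolding Y Z by blast
  have finY: "finite Y" "finite Z" unfolding Y Z using finW by auto
  have cardY: "card Y = a * m"
  proof -
    have "card Y = (\<Sum>i<a. card (W i))" unfolding Y
      by (rule card_UN_disjoint) (use finW Wdisj in auto)
    then show ?thesis using W(2) by simp
  qed
  have cardZ: "card Z = a * m"
  proof -
    have "card Z = (\<Sum>i<a. card (W (a + i)))" unfolding Z
      by (rule card_UN_disjoint) (use finW Wdisj in auto)
    then show ?thesis using W(2) by simp
  qed
  \<comment> \<open>There are as many links as vertices in \<open>Y\<close> and in \<open>Z\<close>,
    so each link has a single vertex in each.\<close>
  have ends: "\<exists>y. P \<inter> A = {y}"
    if A: "P \<in> \<P>" "finite A" "card \<P> = card A" "\<And>P. P \<in> \<P> \<Longrightarrow> P \<inter> A \<noteq> {}" for P A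
  proof -
    obtain f where f: "bij_betw f A \<P>" "\<And>x. x \<in> A \<Longrightarrow> f x \<inter> A = {x}"
      by (rule transversal[OF A(2) P(1) A(3) P(2) A(4)]) (assumption, rule that)
    obtain x where "x \<in> A" "P = f x" using A(1) f(1) unfolding bij_betw_def by blast
    then show ?thesis using f(2) by blast
  qed
  \<comment> \<open>All data of one link in a single tuple, so that one choice fixes ends, pieces
    and interior consistently.\<close>
  define middle where "middle P = (\<lambda>(y, z, i, j, Q). P \<inter> Y = {y} \<and> P \<inter> Z = {z} \<and> i < a \<and> y \<in> W i \<and>
      j < a \<and> z \<in> W (a + j) \<and>
      Q \<subseteq> P \<inter> C \<and> conn ?E Q \<and> (\<exists>u\<in>Q. (y, u) \<in> ?E) \<and> (\<exists>u\<in>Q. (z, u) \<in> ?E))" for P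
  have "\<exists>h. middle P h" if PP: "P \<in> \<P>" for P
  proof -
    obtain y where y: "P \<inter> Y = {y}" using ends[OF PP finY(1)] P(3) cardY L(2) by auto
    obtain z where z: "P \<inter> Z = {z}" using ends[OF PP finY(2)] P(3) cardZ L(2) by auto
    have "y \<in> Y" "z \<in> Z" using y z by auto
    then obtain i j where ij: "i < a" "y \<in> W i" "j < a" "z \<in> W (a + j)" unfolding Y Z by auto
    have PU: "P \<subseteq> C \<union> Y \<union> Z" "conn (touching C ?E) P" using P(3)[OF PP] by auto
    have "finite P" using PU(1) finY C finV by (meson finite_UnI finite_subset)
    moreover have "y \<noteq> z" using \<open>y \<in> Y\<close> \<open>z \<in> Z\<close> YZ by blast
    ultimately obtain Q where "Q \<subseteq> P \<inter> C" "conn ?E Q" "\<exists>u\<in>Q. (y, u) \<in> ?E" "\<exists>u\<in>Q. (z, u) \<in> ?E"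
      using link_interior[OF symE _ PU(2,1) y z _ YC] by blast
    then have "middle P (y, z, i, j, Q)" using y z ij by (simp add: middle_def)
    then show ?thesis by blast
  qed
  then have "\<forall>P\<in>\<P>. \<exists>h. middle P h" by blast
  from bchoice[OF this] obtain h where h: "\<forall>P\<in>\<P>. middle P (h P)" by blast
  define y where "y P = fst (h P)" for P
  define z where "z P = fst (snd (h P))" for P
  define f where "f P = fst (snd (snd (h P)))" for P
  define g where "g P = fst (snd (snd (snd (h P))))" for P
  define Q where "Q P = snd (snd (snd (snd (h P))))" for P
  have F: "P \<inter> Y = {y P}" "P \<inter> Z = {z P}" "f P < a" "y P \<in> W (f P)"
      "g P < a" "z P \<in> W (a + g P)" "Q P \<subseteq> P \<inter> C" "conn ?E (Q P)"
      "\<exists>u\<in>Q P. (y P, u) \<in> ?E" "\<exists>u\<in>Q P. (z P, u) \<in> ?E" if "P \<in> \<P>" for P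
  proof -
    have "middle P (y P, z P, f P, g P, Q P)"
      using bspec[OF h that] by (simp add: y_def z_def f_def g_def Q_def)
    then show "P \<inter> Y = {y P}" "P \<inter> Z = {z P}" "f P < a" "y P \<in> W (f P)"
      "g P < a" "z P \<in> W (a + g P)" "Q P \<subseteq> P \<inter> C" "conn ?E (Q P)"
      "\<exists>u\<in>Q P. (y P, u) \<in> ?E" "\<exists>u\<in>Q P. (z P, u) \<in> ?E"
      by (simp_all add: middle_def)
  qed
  have meet_eq: "l = l'" if "l \<in> \<P>" "l' \<in> \<P>" "x \<in> l" "x \<in> l'" for l l' x
    using disjointD[OF P(2) that(1,2)] that(3,4) by blast
  have yzl: "y l \<in> l" "z l \<in> l" if "l \<in> \<P>" for l using F(1,2)[OF that] by auto
  have inj: "inj_on y \<P>" "inj_on z \<P>"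
    by (rule inj_onI, metis meet_eq yzl)+
  have fib_f: "card {l \<in> \<P>. f l = i} \<le> m" for i
  proof (cases "i < a")
    case True
    let ?L = "{l \<in> \<P>. f l = i}"
    have "card ?L \<le> card (W i)"
    proof (rule card_inj_on_le)
      show "inj_on y ?L" using inj(1) by (rule inj_on_subset) blast
      show "y ` ?L \<subseteq> W i" using F(4) by blast
      show "finite (W i)" using finW[of i] True by simp
    qed
    then show ?thesis using W(2)[of i] True by simp
  next
    case False
    then have "{l \<in> \<P>. f l = i} = {}" using F(3) by blast
    then show ?thesis by (metis card.empty le0)
  qed
  have fib_g: "card {l \<in> \<P>. g l = i} \<le> m" for i
  proof (cases "i < a")
    case True
    let ?L = "{l \<in> \<P>. g l = i}"
    have "card ?L \<le> card (W (a + i))"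
    proof (rule card_inj_on_le)
      show "inj_on z ?L" using inj(2) by (rule inj_on_subset) blast
      show "z ` ?L \<subseteq> W (a + i)" using F(6) by blast
      show "finite (W (a + i))" using finW[of "a + i"] True by simp
    qed
    then show ?thesis using W(2)[of "a + i"] True by simp
  next
    case False
    then have "{l \<in> \<P>. g l = i} = {}" using F(5) by blast
    then show ?thesis by (metis card.empty le0)
  qed
  have fg: "f l < a \<and> g l < a" if "l \<in> \<P>" for l using F(3,5) that by blast
  obtain p q where pq: "inj_on p {..<k}" "inj_on q {..<k}"
    "\<And>t. t < k \<Longrightarrow> p t < a \<and> q t < a \<and> r \<le> card {l \<in> \<P>. f l = p t \<and> g l = q t}"
    using heavy_matching[OF P(1) L(2) fg fib_f fib_g count] by blast
  have "\<exists>e. e ` {..<r} \<subseteq> {l \<in> \<P>. f l = p t \<and> g l = q t} \<and> inj_on e {..<r}" if "t < k" for t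
    by (rule card_le_inj) (use P(1) pq(3)[OF that] in auto)
  then have "\<forall>t\<in>{..<k}. \<exists>e. e ` {..<r} \<subseteq> {l \<in> \<P>. f l = p t \<and> g l = q t} \<and> inj_on e {..<r}" by blast
  from bchoice[OF this] obtain e where
    e: "\<And>t. t < k \<Longrightarrow> e t ` {..<r} \<subseteq> {l \<in> \<P>. f l = p t \<and> g l = q t}"
      "\<And>t. t < k \<Longrightarrow> inj_on (e t) {..<r}" by blast
  have eP: "e t s \<in> \<P>" "f (e t s) = p t" "g (e t s) = q t" if "t < k" "s < r" for t s
    using e(1)[OF that(1)] that(2) by blast+
  define D where "D = case_sum T Q"
  \<comment> \<open>Vertices of the minor are named injectively by pieces and links, and
    \<open>D\<close> turns names into vertex sets. Disjointness of branch sets thus splits into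
    injectivity of \<open>lab\<close> and disjointness of \<open>D\<close>; the offset
    \<open>a\<close> keeps the halves apart.\<close>
  define lab where "lab = (\<lambda>(t, x). case x of Inl s \<Rightarrow> Inl (if s = (0::nat) then p t else a + q t) | Inr s \<Rightarrow> Inr (e t s))"
  define B where "B x = D (lab x)" for x
  let ?H = "disjoint_copies k (complete_bipartite 2 r)"
  have VH: "pverts ?H = {..<k} \<times> (Inl ` {..<2} \<union> Inr ` {..<r})"
    by (simp add: disjoint_copies_def complete_bipartite_def Let_def)
  have lab_dom: "lab x \<in> Inl ` {..<2 * a} \<union> Inr ` \<P>" if "x \<in> pverts ?H" for x
    using that pq(3) eP(1) unfolding VH lab_def by fastforce
  have lab_inj: "inj_on lab (pverts ?H)"
  proof (rule inj_onI)
    fix u v assume uv: "u \<in> pverts ?H" "v \<in> pverts ?H" "lab u = lab v"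
    obtain t x t' x' where tx: "u = (t, x)" "v = (t', x')" by (cases u, cases v)
    have t: "t < k" "t' < k" using uv tx VH by auto
    consider s s' where "x = Inl s" "x' = Inl s'" "s < 2" "s' < 2"
      | s s' where "x = Inr s" "x' = Inr s'" "s < r" "s' < r"
      | "isl x \<noteq> isl x'" using uv tx VH by auto
    then show "u = v"
    proof cases
      case 1
      have "p t < a" "p t' < a" using pq(3) t by auto
      then show ?thesis
        using uv(3) tx 1 t inj_onD[OF pq(1), of t t'] inj_onD[OF pq(2), of t t']
        by (auto simp: lab_def split: if_splits)
    next
      case 2
      then have eq: "e t s = e t' s'" using uv(3) tx by (simp add: lab_def)
      then have "p t = p t'" using eP(2)[OF t(1) 2(3)] eP(2)[OF t(2) 2(4)] by simp
      then have "t = t'" using inj_onD[OF pq(1)] t by simp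
      then have "s = s'" using eq inj_onD[OF e(2)[OF t(1)]] 2 by simp
      then show ?thesis using 2 tx \<open>t = t'\<close> by simp
    next
      case 3
      then show ?thesis using uv(3) tx by (cases x; cases x') (auto simp: lab_def)
    qed
  qed
  have D_disj: "D u \<inter> D v = {}"
    if "u \<in> Inl ` {..<2 * a} \<union> Inr ` \<P>" "v \<in> Inl ` {..<2 * a} \<union> Inr ` \<P>" "u \<noteq> v" for u v
  proof -
    have TQ: "T i \<inter> Q l = {}" if "i < 2 * a" "l \<in> \<P>" for i l
      using T(3)[OF that(1)] F(7)[OF that(2)] by blast
    have TT: "T i \<inter> T j = {}" if "i < 2 * a" "j < 2 * a" "i \<noteq> j" for i j
      using T(4) that by (simp add: disjoint_family_on_def)
    have QQ: "Q l \<inter> Q l' = {}" if "l \<in> \<P>" "l' \<in> \<P>" "l \<noteq> l'" for l l'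
      using disjointD[OF P(2) that] F(7)[OF that(1)] F(7)[OF that(2)] by blast
    have QT: "Q l \<inter> T i = {}" if "i < 2 * a" "l \<in> \<P>" for i l using TQ[OF that] by blast
    show ?thesis using that by (elim UnE imageE) (simp_all add: D_def TQ QT TT QQ)
  qed
  have D_conn: "D u \<subseteq> pverts G \<and> conn ?E (D u)" if "u \<in> Inl ` {..<2 * a} \<union> Inr ` \<P>" for u
  proof -
    have "Q l \<subseteq> pverts G" if "l \<in> \<P>" for l using F(7)[OF that] C by blast
    then show ?thesis using that by (elim UnE imageE) (simp_all add: D_def T(1,2) F(8))
  qed
  have D_adj: "\<exists>u\<in>T (p t). \<exists>v\<in>Q (e t s). (u, v) \<in> ?E" "\<exists>u\<in>T (a + q t). \<exists>v\<in>Q (e t s). (u, v) \<in> ?E"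
    if ts: "t < k" "s < r" for t s
  proof -
    note eP' = eP[OF ts] and F' = F[OF eP(1)[OF ts]]
    have a: "p t < 2 * a" "a + q t < 2 * a" using pq(3)[OF ts(1)] by auto
    show "\<exists>u\<in>T (p t). \<exists>v\<in>Q (e t s). (u, v) \<in> ?E" using F'(9,4) eP' W(1)[OF a(1)] by auto
    show "\<exists>u\<in>T (a + q t). \<exists>v\<in>Q (e t s). (u, v) \<in> ?E" using F'(10,6) eP' W(1)[OF a(2)] by auto
  qed
  have adj: "\<exists>u\<in>B (t, Inl i). \<exists>v\<in>B (t, Inr s). (u, v) \<in> ?E" if "t < k" "s < r" for t i s
    using D_adj[OF that] by (simp add: B_def D_def lab_def)
  show ?thesis
    unfolding minor_of_def
  proof (intro exI[of _ B] conjI ballI)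
    fix x assume x: "x \<in> pverts ?H"
    show "B x \<subseteq> pverts G" using D_conn[OF lab_dom[OF x]] by (simp add: B_def)
    show "Digraph_Component.connected (with_proj G \<restriction> B x)"
      using D_conn[OF lab_dom[OF x]] by (intro connected_induce_subgraph) (simp_all add: B_def)
  next
    show "disjoint_family_on B (pverts ?H)"
      unfolding disjoint_family_on_def B_def
    proof (intro ballI impI)
      fix u v assume uv: "u \<in> pverts ?H" "v \<in> pverts ?H" "u \<noteq> v"
      then have "lab u \<noteq> lab v" using inj_onD[OF lab_inj] by blast
      then show "D (lab u) \<inter> D (lab v) = {}" by (rule D_disj[OF lab_dom[OF uv(1)] lab_dom[OF uv(2)]])
    qed
  next
    fix xy assume "xy \<in> parcs ?H"
    then obtain t x x' where xy: "xy = ((t, x), (t, x'))" "t < k" "(x, x') \<in> parcs (complete_bipartite 2 r)"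
      by (auto simp: disjoint_copies_def)
    have "\<exists>u\<in>B (t, x). \<exists>v\<in>B (t, x'). (u, v) \<in> ?E"
    proof -
      consider i s where "x = Inl i" "x' = Inr s" "s < r" | i s where "x = Inr s" "x' = Inl i" "s < r"
        using xy(3) by (auto simp: complete_bipartite_def Let_def)
      then show ?thesis
      proof cases
        case 1
        then show ?thesis using adj[OF xy(2)] by simp
      next
        case 2
        then show ?thesis using adj[OF xy(2), of s i] symD[OF symE] by blast
      qed
    qed
    then show "case xy of (x, y) \<Rightarrow> \<exists>u\<in>B x. \<exists>v\<in>B y. (u, v) \<in> parcs G" using xy(1) by simp
  qed
qed

section \<open>Building a decomposition\<close>

definition boundary :: "'a rel \<Rightarrow> 'a set \<Rightarrow> 'a set" where
  "boundary E C = {x. x \<notin> C \<and> (\<exists>c\<in>C. (c, x) \<in> E)}"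

text \<open>The root bag is required to contain \<open>X\<close>, so that the list can be hung below
  any bag containing \<open>X\<close>. Arcs inside \<open>X\<close> are left to the bags
  above.\<close>

definition decomposable :: "'a rel \<Rightarrow> nat \<Rightarrow> 'a set \<Rightarrow> 'a set \<Rightarrow> bool" where
  "decomposable E w C X \<longleftrightarrow> (\<exists>bs. rip bs \<and> X \<subseteq> last bs \<and> \<Union>(set bs) = C \<union> X \<and>
     (\<forall>b\<in>set bs. card b \<le> w) \<and>
     (\<forall>u v. (u, v) \<in> E \<longrightarrow> u \<in> C \<longrightarrow> v \<in> C \<union> X \<longrightarrow> (\<exists>b\<in>set bs. u \<in> b \<and> v \<in> b)))"

lemma boundary_component:
  assumes "sym E" "boundary E C \<subseteq> X" "x \<in> C - S"
  shows "boundary E (component E (C - S) x) \<subseteq> X \<union> (S \<inter> C)"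
proof
  fix v assume v: "v \<in> boundary E (component E (C - S) x)"
  then obtain u where u: "u \<in> component E (C - S) x" "(u, v) \<in> E" "v \<notin> component E (C - S) x"
    by (auto simp: boundary_def)
  then have "u \<in> C" using component_subset[of E "C - S" x] by blast
  moreover have "v \<notin> C - S" using component_step[OF assms(1,3) u(1) _ u(2)] u(3) by blast
  ultimately show "v \<in> X \<union> (S \<inter> C)" using u(2) assms(2) by (auto simp: boundary_def)
qed

text \<open>The root bag is \<open>X \<union> S\<close>. A component of \<open>C - S\<close> has its
  boundary in this bag and is disjoint from the other components, so the list for it can be hung
  below the root.\<close>

lemma decomposable_glue:
  assumes "sym E" "finite C" "S \<subseteq> C" "card (X \<union> S) \<le> w" "boundary E C \<subseteq> X" "X \<inter> C = {}"
    and parts: "\<And>x. x \<in> C - S \<Longrightarrow>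
      decomposable E w (component E (C - S) x) (boundary E (component E (C - S) x))"
  shows "decomposable E w C X"
proof -
  let ?K = "component E (C - S)"
  have "\<exists>bs. rip bs \<and> last bs = X \<union> S \<and> \<Union>(set bs) = \<Union>\<K> \<union> X \<union> S \<and> (\<forall>b\<in>set bs. card b \<le> w) \<and>
      (\<forall>u v. (u, v) \<in> E \<longrightarrow> u \<in> \<Union>\<K> \<longrightarrow> v \<in> C \<union> X \<longrightarrow> (\<exists>b\<in>set bs. u \<in> b \<and> v \<in> b))"
    if "finite \<K>" "\<K> \<subseteq> ?K ` (C - S)" for \<K>
    using that
  proof (induction \<K> rule: finite_induct)
    case empty
    then show ?case using assms(4) by (intro exI[of _ "[X \<union> S]"]) (auto intro: rip.single)
  next
    case (insert K \<K>)
    obtain bs where bs: "rip bs" "last bs = X \<union> S" "\<Union>(set bs) = \<Union>\<K> \<union> X \<union> S"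
      "\<And>b. b \<in> set bs \<Longrightarrow> card b \<le> w"
      "\<And>u v. \<lbrakk>(u, v) \<in> E; u \<in> \<Union>\<K>; v \<in> C \<union> X\<rbrakk> \<Longrightarrow> \<exists>b\<in>set bs. u \<in> b \<and> v \<in> b"
      using insert.IH[OF order.trans[OF subset_insertI insert.prems]] by blast
    obtain x where x: "x \<in> C - S" "K = ?K x" using insert.prems by auto
    obtain ds where ds: "rip ds" "boundary E K \<subseteq> last ds" "\<Union>(set ds) = K \<union> boundary E K"
      "\<And>b. b \<in> set ds \<Longrightarrow> card b \<le> w"
      "\<And>u v. \<lbrakk>(u, v) \<in> E; u \<in> K; v \<in> K \<union> boundary E K\<rbrakk> \<Longrightarrow> \<exists>b\<in>set ds. u \<in> b \<and> v \<in> b"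
      using parts[OF x(1)] unfolding decomposable_def x(2)[symmetric] by blast
    have K: "K \<subseteq> C - S" unfolding x(2) by (rule component_subset)
    have bd: "boundary E K \<subseteq> X \<union> S"
      using boundary_component[OF assms(1,5) x(1)] assms(3) x(2) by blast
    have "K \<inter> L = {}" if L: "L \<in> \<K>" for L
    proof (rule ccontr)
      assume "K \<inter> L \<noteq> {}"
      then obtain z where z: "z \<in> K" "z \<in> L" by blast
      obtain y where y: "y \<in> C - S" "L = ?K y" using L insert.prems by auto
      have "?K z = K" using component_eq[OF assms(1) x(1), of z] z x(2) by simp
      moreover have "?K z = L" using component_eq[OF assms(1) y(1), of z] z y(2) by simp
      ultimately show False using L insert.hyps(2) by simp
    qed
    then have disj: "K \<inter> \<Union>(set bs) = {}" using bs(3) K assms(6) by blast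
    have ne: "bs \<noteq> []" using rip_nonempty[OF bs(1)] .
    then have lst: "X \<union> S \<in> set bs" using bs(2) last_in_set by metis
    have "rip (ds @ bs)"
      by (rule rip_append[OF ds(1) bs(1) lst]) (use ds(2,3) bd disj in blast)
    moreover have "last (ds @ bs) = X \<union> S" using ne bs(2) by simp
    moreover have "\<Union>(set (ds @ bs)) = \<Union>(insert K \<K>) \<union> X \<union> S"
      using ds(3) bs(3) bd by auto
    moreover have "\<forall>b\<in>set (ds @ bs). card b \<le> w" using ds(4) bs(4) by auto
    moreover have "\<exists>b\<in>set (ds @ bs). u \<in> b \<and> v \<in> b"
      if uv: "(u, v) \<in> E" "u \<in> \<Union>(insert K \<K>)" "v \<in> C \<union> X" for u v
    proof (cases "u \<in> K")
      case True
      then have "v \<in> K \<union> boundary E K" using uv(1) by (auto simp: boundary_def)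
      then show ?thesis using ds(5)[OF uv(1) True] by auto
    next
      case False
      then show ?thesis using bs(5)[OF uv(1) _ uv(3)] uv(2) by auto
    qed
    ultimately show ?case by (intro exI[of _ "ds @ bs"]) blast
  qed
  from this[OF finite_imageI[OF finite_Diff[OF assms(2)]] order_refl]
  obtain bs where bs: "rip bs" "last bs = X \<union> S"
      "\<Union>(set bs) = \<Union>(?K ` (C - S)) \<union> X \<union> S" "\<forall>b\<in>set bs. card b \<le> w"
      "\<forall>u v. (u, v) \<in> E \<longrightarrow> u \<in> \<Union>(?K ` (C - S)) \<longrightarrow> v \<in> C \<union> X \<longrightarrow> (\<exists>b\<in>set bs. u \<in> b \<and> v \<in> b)"
    by (elim exE conjE) (rule that)
  have un: "\<Union>(?K ` (C - S)) = C - S"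
    using component_subset[of E "C - S"] component_self[of _ "C - S" E] by blast
  have lst: "X \<union> S \<in> set bs" using bs(2) rip_nonempty[OF bs(1)] last_in_set by metis
  have "\<exists>b\<in>set bs. u \<in> b \<and> v \<in> b" if uv: "(u, v) \<in> E" "u \<in> C" "v \<in> C \<union> X" for u v
  proof -
    consider "u \<in> C - S" | "v \<in> C - S" | "u \<in> X \<union> S" "v \<in> X \<union> S" using uv by blast
    then show ?thesis
    proof cases
      case 1
      then have "u \<in> \<Union>(?K ` (C - S))" using un by simp
      then show ?thesis using bs(5) uv(1,3) by blast
    next
      case 2
      then have "v \<in> \<Union>(?K ` (C - S))" using un by simp
      then show ?thesis using bs(5) symD[OF assms(1) uv(1)] uv(2) by blast
    next
      case 3
      then show ?thesis by (intro bexI[OF _ lst] conjI)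
    qed
  qed
  moreover have "\<Union>(set bs) = C \<union> X" unfolding bs(3) un using assms(3) by blast
  moreover have "X \<subseteq> last bs" using bs(2) by simp
  ultimately show ?thesis
    unfolding decomposable_def using bs(1,4) by (intro exI[of _ bs] conjI allI impI)
qed

section \<open>Skeletons\<close>

text \<open>
  A skeleton \<open>(N, F)\<close> is a connected graph of maximum degree three whose nodes are disjoint connected
  vertex sets outside \<open>C\<close> and which carries the attachment vertices \<open>X\<close> of \<open>C\<close>, at most one per node.
  Nodes carrying an attachment vertex have a spare degree, and one of them has two.
\<close>

definition skeleton :: "'a rel \<Rightarrow> 'a set \<Rightarrow> 'a set \<Rightarrow> 'a set \<Rightarrow> 'a set set \<Rightarrow> 'a set rel \<Rightarrow> bool" where
  "skeleton E V C X N F \<longleftrightarrow>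
     sym F \<and> finite N \<and> conn F N \<and> disjoint N \<and> X \<subseteq> \<Union>N \<and> F \<subseteq> N \<times> N \<and>
     (\<forall>n\<in>N. conn E n \<and> n \<subseteq> V \<and> n \<inter> C = {} \<and> card (F `` {n}) \<le> 3 \<and>
        (\<forall>x\<in>n \<inter> X. card (F `` {n}) \<le> 2 \<and> (\<forall>y\<in>n \<inter> X. x = y))) \<and>
     (\<forall>(n, n')\<in>F. \<exists>u\<in>n. \<exists>v\<in>n'. (u, v) \<in> E) \<and>
     (\<exists>n\<in>N. n \<inter> X \<noteq> {} \<and> card (F `` {n}) \<le> 1)"

lemma skeletonD:
  assumes "skeleton E V C X N F"
  shows "sym F" "finite N" "conn F N" "disjoint N" "X \<subseteq> \<Union>N" "F \<subseteq> N \<times> N"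
    and "n \<in> N \<Longrightarrow> conn E n" "n \<in> N \<Longrightarrow> n \<subseteq> V" "n \<in> N \<Longrightarrow> n \<inter> C = {}" "n \<in> N \<Longrightarrow> card (F `` {n}) \<le> 3"
    and "\<lbrakk>n \<in> N; x \<in> n; x \<in> X\<rbrakk> \<Longrightarrow> card (F `` {n}) \<le> 2"
    and "\<lbrakk>n \<in> N; x \<in> n; x \<in> X; y \<in> n; y \<in> X\<rbrakk> \<Longrightarrow> x = y"
    and "(n, n') \<in> F \<Longrightarrow> \<exists>u\<in>n. \<exists>v\<in>n'. (u, v) \<in> E"
    and "\<exists>n\<in>N. n \<inter> X \<noteq> {} \<and> card (F `` {n}) \<le> 1"
  using assms unfolding skeleton_def 
  by - ((elim conjE, assumption) | (elim conjE, drule (1) bspec, (elim conjE)?, (assumption | simp | blast)))+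

text \<open>Each \<open>Q d\<close> becomes a leaf at the node carrying \<open>y d\<close>. As
  \<open>y\<close> is injective and a node carries at most one vertex of \<open>X\<close>, no node
  receives two leaves. The leaves supply the node with two spare degrees that the new skeleton
  needs.\<close>

lemma skeleton_attach:
  assumes sk: "skeleton E V C X N F" and E: "sym E" and CV: "C \<subseteq> V"
    and D: "finite D" "D \<subseteq> C"
    and Q: "\<And>d. d \<in> D \<Longrightarrow> d \<in> Q d" "\<And>d. d \<in> D \<Longrightarrow> Q d \<subseteq> C" "\<And>d. d \<in> D \<Longrightarrow> conn E (Q d)"
      "\<And>d d'. \<lbrakk>d \<in> D; d' \<in> D; d \<noteq> d'\<rbrakk> \<Longrightarrow> Q d \<inter> Q d' = {}"
    and y: "\<And>d. d \<in> D \<Longrightarrow> y d \<in> X" "\<And>d. d \<in> D \<Longrightarrow> \<exists>u\<in>Q d. (y d, u) \<in> E" "inj_on y D"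
    and C': "C' \<subseteq> C" "\<And>d. d \<in> D \<Longrightarrow> C' \<inter> Q d = {}"
    and X': "X' \<subseteq> X \<union> D" "D \<inter> X' \<noteq> {}"
      "\<And>d n. \<lbrakk>d \<in> D; n \<in> N; y d \<in> n; y d \<in> X'\<rbrakk> \<Longrightarrow> card (F `` {n}) \<le> 1"
  shows "\<exists>N' F'. skeleton E V C' X' N' F'"
proof -
  note sk' = skeletonD[OF sk]
  have "\<forall>d\<in>D. \<exists>n. n \<in> N \<and> y d \<in> n" using y(1) sk'(5) by blast
  from bchoice[OF this] obtain nd where nd: "\<And>d. d \<in> D \<Longrightarrow> nd d \<in> N" "\<And>d. d \<in> D \<Longrightarrow> y d \<in> nd d" by blast
  have inj_nd: "d = d'" if "d \<in> D" "d' \<in> D" "nd d = nd d'" for d d'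
  proof -
    have "y d = y d'" using sk'(12)[OF nd(1)[OF that(1)] nd(2)[OF that(1)] y(1)[OF that(1)], of "y d'"]
        nd(2)[OF that(2)] y(1)[OF that(2)] that(3) by simp
    then show ?thesis using y(3) that(1,2) by (simp add: inj_on_def)
  qed
  have XC: "X \<inter> C = {}" using sk'(5,9) by blast
  have QN: "Q d \<notin> N" "n \<inter> Q d = {}" if "d \<in> D" "n \<in> N" for d n
    using Q(1,2)[OF that(1)] sk'(9)[OF that(2)] sk'(9)[of "Q d"] by blast+
  have inj_Q: "d = d'" if "d \<in> D" "d' \<in> D" "Q d = Q d'" for d d'
    using Q(4)[OF that(1,2)] Q(1)[OF that(1)] that(3) by blast
  have QX: "x = d" if "d \<in> D" "x \<in> Q d" "x \<in> X'" for d x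
    using X'(1) that XC Q(2)[OF that(1)] Q(1)[of x] Q(4)[of d x] by blast
  let ?N = "N \<union> Q ` D"
  let ?F = "F \<union> (\<lambda>d. (nd d, Q d)) ` D \<union> (\<lambda>d. (Q d, nd d)) ` D"
  have old: "?F `` {n} = F `` {n} \<union> {Q d | d. d \<in> D \<and> nd d = n}" if "n \<in> N" for n
    using QN that by auto
  have new: "?F `` {Q d} = {nd d}" if "d \<in> D" for d
  proof -
    have "F `` {Q d} = {}" using sk'(6) QN(1)[OF that nd(1)[OF that]] by blast
    moreover have "Q d \<noteq> nd d'" if "d' \<in> D" for d' using QN(1)[OF \<open>d \<in> D\<close> nd(1)[OF that]] nd(1)[OF that] by auto
    ultimately show ?thesis using that inj_Q by auto
  qed
  have card_new: "card (?F `` {Q d}) = 1" if "d \<in> D" for d using new[OF that] by simp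
  have deg_D: "card (?F `` {nd d}) \<le> Suc (card (F `` {nd d}))" if "d \<in> D" for d
  proof -
    have "?F `` {nd d} = insert (Q d) (F `` {nd d})"
      unfolding old[OF nd(1)[OF that]] using inj_nd[OF _ that] that by blast
    moreover have "finite (F `` {nd d})"
      by (rule finite_subset[OF _ sk'(2)]) (use sk'(6) in blast)
    ultimately show ?thesis by (simp add: card_insert_if)
  qed
  have deg_other: "?F `` {n} = F `` {n}" if "n \<in> N" "\<And>d. d \<in> D \<Longrightarrow> n \<noteq> nd d" for n
    unfolding old[OF that(1)] using that(2) by blast
  have conF: "conn ?F ?N"
  proof (rule connI)
    show "?N \<noteq> {}" using conn_nonempty[OF sk'(3)] by simp
    fix B assume B: "B \<inter> ?N \<noteq> {}" "\<And>u v. \<lbrakk>u \<in> B; u \<in> ?N; v \<in> ?N; (u, v) \<in> ?F\<rbrakk> \<Longrightarrow> v \<in> B"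
    have "B \<inter> N \<noteq> {}"
    proof (cases "B \<inter> Q ` D = {}")
      case False
      then obtain d where d: "d \<in> D" "Q d \<in> B" by blast
      then have "nd d \<in> B" using B(2)[of "Q d" "nd d"] nd(1)[OF d(1)] by blast
      then show ?thesis using nd(1)[OF d(1)] by blast
    qed (use B(1) in blast)
    then have "N \<subseteq> B" by (rule conn_closed[OF sk'(3)]) (use B(2) in blast)
    moreover have "Q d \<in> B" if "d \<in> D" for d
      using B(2)[of "nd d" "Q d"] nd(1)[OF that] that \<open>N \<subseteq> B\<close> by blast
    ultimately show "?N \<subseteq> B" by blast
  qed
  have symF: "sym ?F" using sk'(1) by (auto simp: sym_def)
  have dis: "disjoint ?N"
  proof (rule disjointI)
    fix a b assume ab: "a \<in> ?N" "b \<in> ?N" "a \<noteq> b"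
    show "a \<inter> b = {}"
      using ab(1)
    proof
      assume a: "a \<in> N"
      show ?thesis using ab(2)
      proof
        assume "b \<in> N" then show ?thesis using disjointD[OF sk'(4) a] ab(3) by blast
      next
        assume "b \<in> Q ` D" then show ?thesis using QN(2) a by blast
      qed
    next
      assume a: "a \<in> Q ` D"
      show ?thesis using ab(2)
      proof
        assume "b \<in> N" then show ?thesis using QN(2) a by blast
      next
        assume "b \<in> Q ` D" then show ?thesis using Q(4) a ab(3) by blast
      qed
    qed
  qed
  have cov: "X' \<subseteq> \<Union>?N" using X'(1) sk'(5) Q(1) by blast
  have FN: "?F \<subseteq> ?N \<times> ?N" using sk'(6) nd(1) by blast
  have adj: "\<exists>u\<in>n. \<exists>v\<in>n'. (u, v) \<in> E" if "(n, n') \<in> ?F" for n n'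
  proof -
    consider "(n, n') \<in> F" | d where "d \<in> D" "n = nd d" "n' = Q d" | d where "d \<in> D" "n = Q d" "n' = nd d"
      using \<open>(n, n') \<in> ?F\<close> by blast
    then show ?thesis
    proof cases
      case 1 then show ?thesis by (rule sk'(13))
    next
      case 2 then show ?thesis using nd(2) y(2) by blast
    next
      case 3 then show ?thesis using nd(2) y(2) symD[OF E] by blast
    qed
  qed
  have nodeN: "conn E n \<and> n \<subseteq> V \<and> n \<inter> C' = {} \<and> card (?F `` {n}) \<le> 3 \<and>
        (\<forall>x\<in>n \<inter> X'. card (?F `` {n}) \<le> 2 \<and> (\<forall>z\<in>n \<inter> X'. x = z))" if n: "n \<in> N" for n
  proof -
    have nX: "n \<inter> X' \<subseteq> X" using X'(1) D(2) sk'(9)[OF n] by blast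
    \<comment> \<open>A node that receives a leaf had degree at most 2, so 3 is not exceeded. If it
      still carries a vertex of \<open>X'\<close>, that vertex is \<open>y d\<close> and the degree
      was at most 1.\<close>
    have deg: "card (?F `` {n}) \<le> 3 \<and> (n \<inter> X' \<noteq> {} \<longrightarrow> card (?F `` {n}) \<le> 2)"
    proof (cases "\<exists>d\<in>D. n = nd d")
      case True
      then obtain d where d: "d \<in> D" "n = nd d" by blast
      have y2: "card (F `` {n}) \<le> 2" using sk'(11)[OF n nd(2)[OF d(1), folded d(2)] y(1)[OF d(1)]] .
      have le1: "card (F `` {n}) \<le> 1" if ne: "n \<inter> X' \<noteq> {}"
      proof -
        obtain x where x: "x \<in> n" "x \<in> X'" using ne by blast
        have "x = y d"
          using sk'(12)[OF n x(1) _ nd(2)[OF d(1), folded d(2)] y(1)[OF d(1)]] nX x by blast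
        then show ?thesis using X'(3)[OF d(1) n] x by blast
      qed
      have le: "card (?F `` {n}) \<le> Suc (card (F `` {n}))" using deg_D[OF d(1)] d(2) by simp
      show ?thesis
      proof (intro conjI impI)
        show "card (?F `` {n}) \<le> 3" using le y2 by linarith
        show "card (?F `` {n}) \<le> 2" if "n \<inter> X' \<noteq> {}" using le le1[OF that] by linarith
      qed
    next
      case False
      then have "?F `` {n} = F `` {n}" using deg_other[OF n] by blast
      moreover have "card (F `` {n}) \<le> 2" if "n \<inter> X' \<noteq> {}"
        using that nX by (blast intro: sk'(11)[OF n])
      ultimately show ?thesis using sk'(10)[OF n] by simp
    qed
    have "x = z" if "x \<in> n \<inter> X'" "z \<in> n \<inter> X'" for x z
      using sk'(12)[OF n, of x z] nX that by blast
    then show ?thesis using deg sk'(7,8,9)[OF n] C'(1) by blast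
  qed
  have nodeQ: "conn E n \<and> n \<subseteq> V \<and> n \<inter> C' = {} \<and> card (?F `` {n}) \<le> 3 \<and>
        (\<forall>x\<in>n \<inter> X'. card (?F `` {n}) \<le> 2 \<and> (\<forall>z\<in>n \<inter> X'. x = z))" if n: "n \<in> Q ` D" for n
  proof -
    obtain d where d: "d \<in> D" "n = Q d" using n by blast
    have "x = z" if "x \<in> n \<inter> X'" "z \<in> n \<inter> X'" for x z
      using QX[OF d(1), of x] QX[OF d(1), of z] that d(2) by blast
    moreover have "n \<subseteq> V" "n \<inter> C' = {}" using Q(2)[OF d(1)] C'(2)[OF d(1)] CV d(2) by auto
    ultimately show ?thesis using card_new[OF d(1)] Q(3)[OF d(1)] d(2) by simp
  qed
  obtain d where d: "d \<in> D" "d \<in> X'" using X'(2) by blast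
  then have leaf: "\<exists>n\<in>?N. n \<inter> X' \<noteq> {} \<and> card (?F `` {n}) \<le> 1"
    using card_new[OF d(1)] Q(1)[OF d(1)] by (intro bexI[of _ "Q d"]) auto
  have fin: "finite ?N" using sk'(2) D(1) by simp
  have nodes: "\<forall>n\<in>?N. conn E n \<and> n \<subseteq> V \<and> n \<inter> C' = {} \<and> card (?F `` {n}) \<le> 3 \<and>
        (\<forall>x\<in>n \<inter> X'. card (?F `` {n}) \<le> 2 \<and> (\<forall>z\<in>n \<inter> X'. x = z))"
    by (rule ballI, erule UnE, erule nodeN, erule nodeQ)
  have adj': "\<forall>(n, n')\<in>?F. \<exists>u\<in>n. \<exists>v\<in>n'. (u, v) \<in> E"
    using adj by (intro ballI case_prodI2) simp
  have "skeleton E V C' X' ?N ?F"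
    unfolding skeleton_def using symF fin conF dis cov FN nodes adj' leaf by (intro conjI)
  then show ?thesis by blast
qed

lemma conn_touching:
  assumes "K \<subseteq> C" "conn E K"
  shows "conn (touching C E) K"
proof (rule connI)
  fix D assume D: "D \<inter> K \<noteq> {}"
    "\<And>u v. \<lbrakk>u \<in> D; u \<in> K; v \<in> K; (u, v) \<in> touching C E\<rbrakk> \<Longrightarrow> v \<in> D"
  show "K \<subseteq> D"
    by (rule conn_closed[OF assms(2) D(1)]) (use D(2) assms(1) in \<open>auto simp: touching_def\<close>)
qed (rule conn_nonempty[OF assms(2)])

text \<open>Added to \<open>K\<close>, the vertices \<open>y\<close> and \<open>z\<close> form a
  connected set from \<open>Y\<close> to \<open>Z\<close>. With \<open>K = C\<close> this forces the
  separator into \<open>C\<close>; with \<open>K\<close> a component of \<open>C - S\<close> it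
  shows that \<open>K\<close> cannot see both \<open>Y - S\<close> and \<open>Z - S\<close>.\<close>

lemma separator_meets_join:
  assumes "sym E" "conn E K" "K \<subseteq> C" "y \<in> boundary E K" "z \<in> boundary E K" "y \<in> Y" "z \<in> Z"
    and "separates (touching C E) (C \<union> Y \<union> Z) S Y Z"
  shows "(K \<union> {y, z}) \<inter> S \<noteq> {}"
proof -
  let ?E = "touching C E"
  have s: "sym ?E" by (rule sym_touching[OF assms(1)])
  have adj: "\<exists>k\<in>K. (k, x) \<in> ?E" if "x \<in> boundary E K" for x
    using that assms(3) by (auto simp: boundary_def touching_def)
  have "conn ?E (K \<union> {y})"
    by (rule conn_Un[OF s conn_touching[OF assms(3,2)] conn_singleton]) (use adj[OF assms(4)] in blast)
  then have "conn ?E (K \<union> {y} \<union> {z})"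
    by (rule conn_Un[OF s _ conn_singleton]) (use adj[OF assms(5)] in blast)
  then have "conn ?E (K \<union> {y, z})" by (simp add: Un_assoc insert_commute)
  moreover have "K \<union> {y, z} \<subseteq> C \<union> Y \<union> Z" "(K \<union> {y, z}) \<inter> Y \<noteq> {}" "(K \<union> {y, z}) \<inter> Z \<noteq> {}"
    using assms(3,6,7) by auto
  ultimately show ?thesis using assms(8) unfolding separates_def by blast
qed

text \<open>
  The new nodes continue the skeleton from \<open>Y\<close> to \<open>S \<inter> C\<close>. They use up the spare degree of nodes whose
  attachment vertex lies in \<open>Y - S\<close>, which \<open>K\<close> does not see any more.
\<close>

lemma skeleton_past_separator:
  assumes sk: "skeleton E V C X N F" and E: "sym E" and CV: "C \<subseteq> V" "finite V" "conn E C"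
    and X: "X = boundary E C" and YZ: "Y \<subseteq> X" "Z \<subseteq> X" "Y \<inter> Z = {}"
    and S: "S \<subseteq> C \<union> Y \<union> Z" "separates (touching C E) (C \<union> Y \<union> Z) S Y Z"
      "\<And>R. \<lbrakk>R \<subseteq> C \<union> Y \<union> Z; separates (touching C E) (C \<union> Y \<union> Z) R Y Z\<rbrakk> \<Longrightarrow> card S \<le> card R"
    and ne: "S \<inter> C \<noteq> {}"
    and K: "x \<in> C - S" "K = component E (C - S) x" "boundary E K \<inter> (Y - S) = {}"
  shows "\<exists>N' F'. skeleton E V K (boundary E K) N' F'"
proof -
  let ?E = "touching C E" and ?U = "C \<union> Y \<union> Z" and ?D = "S \<inter> C"
  have s: "sym ?E" by (rule sym_touching[OF E])
  have XC: "X \<inter> C = {}" unfolding X boundary_def by blast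
  have XV: "X \<subseteq> V" using skeletonD(5,8)[OF sk] by blast
  have finU: "finite ?U" using CV(1,2) XV YZ(1,2) by (meson finite_subset Un_least subset_trans)
  have finS: "finite S" using S(1) finU finite_subset by blast
  have KC: "K \<subseteq> C - S" unfolding K(2) by (rule component_subset)
  have Kconn: "conn E K" unfolding K(2) by (rule conn_component[OF K(1)])
  \<comment> \<open>Every connected set from \<open>Y\<close> to \<open>Z\<close> meets
    \<open>S\<close>, so whatever separates \<open>Y\<close> from \<open>S\<close> also separates
    \<open>Y\<close> from \<open>Z\<close>, and is no smaller than \<open>S\<close>.\<close>
  have "\<exists>\<P>. linkage ?E ?U Y S \<P> \<and> card \<P> = card S"
  proof (rule menger[OF s finU _ S(1)])
    fix R assume R: "R \<subseteq> ?U" "separates ?E ?U R Y S"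
    have "separates ?E ?U R Y Z"
      unfolding separates_def
    proof (intro allI impI)
      fix P assume P: "P \<subseteq> ?U" "conn ?E P" "P \<inter> Y \<noteq> {}" "P \<inter> Z \<noteq> {}"
      then have "P \<inter> S \<noteq> {}" using S(2) by (simp add: separates_def)
      then show "P \<inter> R \<noteq> {}" using R(2) P by (simp add: separates_def)
    qed
    then show "card S \<le> card R" by (rule S(3)[OF R(1)])
  qed blast
  then obtain \<P> where L: "linkage ?E ?U Y S \<P>" "card \<P> = card S" by blast
  note P = linkageD[OF L(1)]
  obtain f where f: "bij_betw f S \<P>" "\<And>s. s \<in> S \<Longrightarrow> f s \<inter> S = {s}"
    by (rule transversal[OF finS P(1) L(2) P(2)]) (use P(3) in simp, rule that)
  have fP: "f d \<in> \<P>" if "d \<in> S" for d using f(1) that by (auto simp: bij_betw_def)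
  have f_disj: "f d \<inter> f d' = {}" if "d \<in> S" "d' \<in> S" "d \<noteq> d'" for d d'
  proof -
    have "f d \<noteq> f d'" using f(1) that by (auto simp: bij_betw_def inj_on_def)
    then show ?thesis using disjointD[OF P(2) fP[OF that(1)] fP[OF that(2)]] by blast
  qed
  define path where "path d y Q \<longleftrightarrow> Q \<subseteq> f d \<and> Q \<inter> Y = {y} \<and> d \<in> Q \<and> conn ?E Q \<and> conn ?E (Q - {y}) \<and>
    conn ?E (Q - {d})" for d y Q
  have "\<exists>h. path d (fst h) (snd h)" if d: "d \<in> ?D" for d
  proof -
    have p: "f d \<subseteq> ?U" "conn ?E (f d)" "f d \<inter> Y \<noteq> {}" using P(3)[OF fP] d by auto
    have "finite (f d)" using p(1) finU finite_subset by blast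
    moreover have "d \<in> f d" "d \<notin> Y" using f(2)[of d] d YZ(1) XC by blast+
    ultimately obtain Q y where "Q \<subseteq> f d" "Q \<inter> Y = {y}" "d \<in> Q" "conn ?E Q" "conn ?E (Q - {y})" "conn ?E (Q - {d})"
      by (rule conn_between[OF s _ p(2,3)])
    then show ?thesis by (intro exI[of _ "(y, Q)"]) (simp add: path_def)
  qed
  then have "\<forall>d\<in>?D. \<exists>h. path d (fst h) (snd h)" by blast
  from bchoice[OF this] obtain h where h: "\<forall>d\<in>?D. path d (fst (h d)) (snd (h d))" by blast
  define y where "y d = fst (h d)" for d
  define R where "R d = snd (h d)" for d
  have R: "R d \<subseteq> f d" "R d \<inter> Y = {y d}" "d \<in> R d" "conn ?E (R d)" "conn ?E (R d - {y d})"
    "conn ?E (R d - {d})" if "d \<in> ?D" for d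
    using bspec[OF h that] by (simp_all add: path_def y_def R_def)
  have RU: "R d \<subseteq> ?U" if "d \<in> ?D" for d using R(1)[OF that] P(3)[OF fP] that by blast
  have RS: "R d \<inter> S = {d}" if "d \<in> ?D" for d using R(1,3)[OF that] f(2) that by blast
  have yR: "y d \<in> R d" "y d \<in> Y" "y d \<noteq> d" "y d \<notin> S" if "d \<in> ?D" for d
  proof -
    show y: "y d \<in> R d" "y d \<in> Y" using R(2)[OF that] by auto
    have "d \<notin> Y" using that YZ(1) XC by blast
    then show ne: "y d \<noteq> d" using y(2) by metis
    show "y d \<notin> S" using RS[OF that] y(1) ne by blast
  qed
  \<comment> \<open>Without \<open>d\<close> the set is still connected, contains \<open>y d\<close>
    and avoids \<open>S\<close>; meeting \<open>Z\<close>, it would contradict the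
    separation.\<close>
  have RZ: "R d \<inter> Z = {}" if d: "d \<in> ?D" for d
  proof (rule ccontr)
    assume "R d \<inter> Z \<noteq> {}"
    then have "(R d - {d}) \<inter> Z \<noteq> {}" using d YZ(2) XC by blast
    moreover have "(R d - {d}) \<inter> Y \<noteq> {}" using yR[OF d] by blast
    moreover have "R d - {d} \<subseteq> ?U" using RU[OF d] by blast
    ultimately have "(R d - {d}) \<inter> S \<noteq> {}" using S(2) R(6)[OF d] unfolding separates_def by blast
    then show False using RS[OF d] by blast
  qed
  have RC: "R d - {y d} \<subseteq> C" if "d \<in> ?D" for d using RU[OF that] RZ[OF that] R(2)[OF that] by blast
  have y_bd: "y d \<notin> boundary E K" if "d \<in> ?D" for d using K(3) yR(2,4)[OF that] by blast
  \<comment> \<open>New nodes must stay outside \<open>K\<close>. Otherwise \<open>R d - {d}\<close>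
    would leave \<open>K\<close> either to \<open>y d\<close>, which is not in the boundary of
    \<open>K\<close>, or to a vertex of \<open>C - S\<close>, which would belong to
    \<open>K\<close>.\<close>
  have KR: "K \<inter> (R d - {y d}) = {}" if d: "d \<in> ?D" for d
  proof (rule ccontr)
    assume meet: "K \<inter> (R d - {y d}) \<noteq> {}"
    have "d \<notin> K" using d KC by blast
    then have "K \<inter> (R d - {d}) \<noteq> {}" using meet by blast
    moreover have "\<not> R d - {d} \<subseteq> K" using yR[OF d] KC YZ(1) XC by blast
    ultimately obtain u v where uv: "u \<in> K" "v \<in> R d - {d}" "v \<notin> K" "(u, v) \<in> ?E"
      by (rule conn_crossing[OF R(6)[OF d]])
    have uvE: "(u, v) \<in> E" using uv(4) touching_subset[of C E] by blast
    have "v \<noteq> y d" using y_bd[OF d] uv(1,3) uvE by (auto simp: boundary_def)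
    then have "v \<in> C - S" using uv(2) RC[OF d] RS[OF d] by blast
    then show False using component_step[OF E K(1) _ _ uvE] uv(1,3) K(2) by blast
  qed
  have bdK: "boundary E K \<subseteq> X \<union> ?D"
    unfolding K(2) by (rule boundary_component[OF E _ K(1)]) (simp add: X)
  show ?thesis
  proof (rule skeleton_attach[OF sk E CV(1), where D = ?D and Q = "\<lambda>d. R d - {y d}" and y = y])
    show "finite ?D" using finS by simp
    show "d \<in> R d - {y d}" if "d \<in> ?D" for d using R(3)[OF that] yR(3)[OF that] by auto
    show "conn E (R d - {y d})" if "d \<in> ?D" for d
      by (rule conn_mono[OF R(5)[OF that] touching_subset])
    show "(R d - {y d}) \<inter> (R d' - {y d'}) = {}" if "d \<in> ?D" "d' \<in> ?D" "d \<noteq> d'" for d d'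
      using f_disj[of d d'] R(1)[OF that(1)] R(1)[OF that(2)] that by blast
    show "y d \<in> X" if "d \<in> ?D" for d using yR(2)[OF that] YZ(1) by blast
    show "\<exists>u\<in>R d - {y d}. (y d, u) \<in> E" if d: "d \<in> ?D" for d
    proof -
      have "{y d} \<inter> R d \<noteq> {}" "\<not> R d \<subseteq> {y d}" using yR[OF d] R(3)[OF d] by auto
      then obtain u v where "u \<in> {y d}" "v \<in> R d" "v \<notin> {y d}" "(u, v) \<in> ?E"
        by (rule conn_crossing[OF R(4)[OF d]])
      then show ?thesis using touching_subset[of C E] by blast
    qed
    show "inj_on y ?D"
    proof (rule inj_onI)
      fix d d' assume d: "d \<in> ?D" "d' \<in> ?D" "y d = y d'"
      then have "y d \<in> f d \<inter> f d'" using yR(1) R(1) by (metis IntI subsetD)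
      then show "d = d'" using f_disj[of d d'] d by blast
    qed
    \<comment> \<open>\<open>C\<close> is connected and larger than \<open>K\<close>, so some arc
      leads from \<open>K\<close> to the rest of \<open>C\<close>; it can only end in
      \<open>S\<close>.\<close>
    show "?D \<inter> boundary E K \<noteq> {}"
    proof -
      have "K \<inter> C \<noteq> {}" "\<not> C \<subseteq> K" using conn_nonempty[OF Kconn] KC ne by blast+
      then obtain u v where uv: "u \<in> K" "v \<in> C" "v \<notin> K" "(u, v) \<in> E"
        by (rule conn_crossing[OF CV(3)])
      then have "v \<in> S" using component_step[OF E K(1) _ _ uv(4)] K(2) by blast
      then show ?thesis using uv by (auto simp: boundary_def)
    qed
  qed (use KC KR RC bdK y_bd in blast)+
qed

text \<open>The vertices of \<open>Y - S\<close> are lost and those of \<open>S \<inter> C\<close>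
  are gained. The gain is at most \<open>card S - card (Y \<inter> S)\<close>, which
  \<open>card S \<le> card Y\<close> bounds by the loss.\<close>

lemma card_past_separator:
  assumes "finite X" "finite S" "Y \<subseteq> X" "X \<inter> C = {}" "card S \<le> card Y"
    and "B \<subseteq> X \<union> (S \<inter> C)" "B \<inter> (Y - S) = {}"
  shows "card B \<le> card X"
proof -
  have "card B \<le> card ((X - (Y - S)) \<union> (S \<inter> C))"
    by (rule card_mono) (use assms in auto)
  also have "\<dots> \<le> card (X - (Y - S)) + card (S \<inter> C)" by (rule card_Un_le)
  also have "card (X - (Y - S)) = card X - card (Y - S)"
    using assms(1,3) by (intro card_Diff_subset) (auto intro: finite_subset)
  finally have 1: "card B \<le> card X - card (Y - S) + card (S \<inter> C)" .
  have finY: "finite Y" using assms(1,3) finite_subset by blast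
  have "card Y = card (Y - S) + card (Y \<inter> S)"
    using finY by (metis add.commute card_Int_Diff)
  moreover have "card (Y \<inter> S) + card (S \<inter> C) = card ((Y \<inter> S) \<union> (S \<inter> C))"
    by (rule card_Un_disjoint[symmetric]) (use assms finY in auto)
  moreover have "card ((Y \<inter> S) \<union> (S \<inter> C)) \<le> card S"
    by (rule card_mono) (use assms(2) in auto)
  moreover have "card (Y - S) \<le> card X" by (rule card_mono) (use assms(1,3) in auto)
  ultimately show ?thesis using 1 assms(5) by linarith
qed

text \<open>The recursion with minors abstracted away: all it needs is a separator of fewer than
  \<open>n\<close> vertices whenever the attachment set is full. It descends to components of
  \<open>C\<close> minus a set meeting \<open>C\<close>, and bags have at most
  \<open>h + (n - 1)\<close> vertices.\<close>

lemma decomposable_if_separable: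
  assumes E: "sym E" and V: "finite V" and n: "n > 0"
    and sep: "\<And>C X N F. \<lbrakk>skeleton E V C X N F; conn E C; C \<subseteq> V; X = boundary E C; card X = h\<rbrakk> \<Longrightarrow>
      \<exists>Y Z S. Y \<subseteq> X \<and> Z \<subseteq> X \<and> Y \<inter> Z = {} \<and> card Y = n \<and> card Z = n \<and> S \<subseteq> C \<union> Y \<union> Z \<and>
        separates (touching C E) (C \<union> Y \<union> Z) S Y Z \<and> card S < n"
  shows "\<lbrakk>skeleton E V C X N F; conn E C; C \<subseteq> V; X = boundary E C; card X \<le> h\<rbrakk> \<Longrightarrow>
    decomposable E (h + n - 1) C X"
proof (induction "card C" arbitrary: C X N F rule: less_induct)
  case less
  note sk = less.prems(1) and C = less.prems(2,3) and X = less.prems(4)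
  have finC: "finite C" using C(2) V finite_subset by blast
  have XC: "X \<inter> C = {}" unfolding X boundary_def by blast
  have finX: "finite X" using skeletonD(5,8)[OF sk] V by (meson Sup_least finite_subset)
  have bdX: "boundary E C \<subseteq> X" using X by simp
  have step: "decomposable E (h + n - 1) (component E (C - S) x) (boundary E (component E (C - S) x))"
    if "x \<in> C - S" "S \<inter> C \<noteq> {}" "skeleton E V (component E (C - S) x) (boundary E (component E (C - S) x)) N' F'"
      "card (boundary E (component E (C - S) x)) \<le> h" for S x N' F'
  proof (rule less.hyps[OF _ that(3) conn_component[OF that(1)] _ refl that(4)])
    have "component E (C - S) x \<subset> C" using component_subset[of E "C - S" x] that(2) by blast
    then show "card (component E (C - S) x) < card C" "component E (C - S) x \<subseteq> V"
      using psubset_card_mono[OF finC] C(2) by blast+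
  qed
  show ?case
  proof (cases "card X < h")
    case True
    \<comment> \<open>The node with two spare degrees: a leaf may be hung on it although
      \<open>x\<close> can remain an attachment vertex.\<close>
    obtain m x where m: "m \<in> N" "x \<in> m" "x \<in> X" "card (F `` {m}) \<le> 1"
      using skeletonD(14)[OF sk] by blast
    obtain u where u: "u \<in> C" "(u, x) \<in> E" using m(3) X by (auto simp: boundary_def)
    have cardXu: "card (X \<union> {u}) \<le> h" using True card_insert_le_m1[of h X u] finX by (simp add: card_insert_if)
    show ?thesis
    proof (rule decomposable_glue[OF E finC _ _ bdX XC, where S = "{u}"])
      fix c assume c: "c \<in> C - {u}"
      let ?K = "component E (C - {u}) c"
      have K: "?K \<subseteq> C - {u}" "?K \<noteq> {}"
        using component_subset[of E "C - {u}" c] component_self[OF c, of E] by blast+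
      have bd: "boundary E ?K \<subseteq> X \<union> {u}" using boundary_component[OF E bdX c] by blast
      have "?K \<inter> C \<noteq> {}" "\<not> C \<subseteq> ?K" using K u(1) by blast+
      then obtain a b where ab: "a \<in> ?K" "b \<in> C" "b \<notin> ?K" "(a, b) \<in> E"
        by (rule conn_crossing[OF C(1)])
      then have "b = u" using component_step[OF E c ab(1) _ ab(4)] by blast
      then have ubd: "u \<in> boundary E ?K" using ab by (auto simp: boundary_def)
      have "\<exists>N' F'. skeleton E V ?K (boundary E ?K) N' F'"
      proof (rule skeleton_attach[OF sk E C(2), where D = "{u}" and Q = "\<lambda>_. {u}" and y = "\<lambda>_. x"])
        show "conn E {u}" by (rule conn_singleton)
        show "\<exists>u\<in>{u}. (x, u) \<in> E" using symD[OF E u(2)] by blast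
        show "card (F `` {m'}) \<le> 1" if "m' \<in> N" "x \<in> m'" for m'
          using disjointD[OF skeletonD(4)[OF sk] m(1) that(1)] m(2,4) that(2) by blast
      qed (use u(1) m(3) K bd ubd in auto)
      moreover have "card (boundary E ?K) \<le> h"
        using card_mono[OF _ bd] cardXu finX by simp
      ultimately show "decomposable E (h + n - 1) ?K (boundary E ?K)"
        using step[OF c] u(1) by blast
    qed (use u(1) cardXu n in auto)
  next
    case False
    then have h: "card X = h" using less.prems(5) by simp
    obtain Y Z S\<^sub>0 where YZ: "Y \<subseteq> X" "Z \<subseteq> X" "Y \<inter> Z = {}" "card Y = n" "card Z = n"
      and S\<^sub>0: "S\<^sub>0 \<subseteq> C \<union> Y \<union> Z \<and> separates (touching C E) (C \<union> Y \<union> Z) S\<^sub>0 Y Z" "card S\<^sub>0 < n"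
      using sep[OF sk C X h] by blast
    \<comment> \<open>The given separator is replaced by one of least size, which the linkage
      extending the skeleton requires.\<close>
    let ?sep = "\<lambda>S. S \<subseteq> C \<union> Y \<union> Z \<and> separates (touching C E) (C \<union> Y \<union> Z) S Y Z"
    have "\<exists>S. ?sep S \<and> (\<forall>S'. ?sep S' \<longrightarrow> card S \<le> card S')"
      by (rule ex_has_least_nat[of ?sep, OF S\<^sub>0(1)])
    then obtain S where S: "?sep S" and least: "\<forall>S'. ?sep S' \<longrightarrow> card S \<le> card S'"
      by (elim exE conjE) (rule that, auto)
    have cardS: "card S < n" using least S\<^sub>0 by (meson le_less_trans)
    have finS: "finite S"
      using S finC finX YZ(1,2) by (meson finite_UnI finite_subset)
    have out: "\<exists>y\<in>A. y \<notin> S" if "card A = n" for A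
      using that cardS card_mono[OF finS, of A] by (meson linorder_not_less subsetI)
    \<comment> \<open>\<open>Y\<close> and \<open>Z\<close> have \<open>n\<close> vertices each, so
      both have one outside \<open>S\<close>, and \<open>C\<close> joins these two.\<close>
    have ne: "S \<inter> C \<noteq> {}"
    proof
      assume SC: "S \<inter> C = {}"
      obtain y z where yz: "y \<in> Y" "y \<notin> S" "z \<in> Z" "z \<notin> S" using out YZ(4,5) by blast
      have "(C \<union> {y, z}) \<inter> S \<noteq> {}"
        by (rule separator_meets_join[OF E C(1) order_refl _ _ yz(1,3)]) (use S yz YZ X in auto)
      then show False using SC yz by blast
    qed
    have comm: "C \<union> Z \<union> Y = C \<union> Y \<union> Z" by blast
    have eqC: "C - (S \<inter> C) = C - S" by blast
    show ?thesis
    proof (rule decomposable_glue[OF E finC _ _ bdX XC, where S = "S \<inter> C"])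
      have "card (X \<union> (S \<inter> C)) \<le> card X + card (S \<inter> C)" by (rule card_Un_le)
      also have "card (S \<inter> C) \<le> card S" by (rule card_mono[OF finS]) blast
      finally show "card (X \<union> (S \<inter> C)) \<le> h + n - 1" using h cardS by simp
    next
      fix c assume "c \<in> C - (S \<inter> C)"
      then have c: "c \<in> C - S" by blast
      let ?K = "component E (C - S) c"
      have K: "?K \<subseteq> C - S" "conn E ?K" using component_subset[of E "C - S" c] conn_component[OF c] by auto
      then have KC: "?K \<subseteq> C" by blast
      have bd: "boundary E ?K \<subseteq> X \<union> (S \<inter> C)" by (rule boundary_component[OF E bdX c])
      have "boundary E ?K \<inter> (Y - S) = {} \<or> boundary E ?K \<inter> (Z - S) = {}"
      proof (rule ccontr)
        assume "\<not> ?thesis"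
        then obtain y z where yz: "y \<in> boundary E ?K" "y \<in> Y" "y \<notin> S" "z \<in> boundary E ?K" "z \<in> Z" "z \<notin> S"
          by blast
        have "(?K \<union> {y, z}) \<inter> S \<noteq> {}"
          by (rule separator_meets_join[OF E K(2) KC yz(1,4,2,5)]) (use S in blast)
        then show False using K yz by blast
      qed
      then have "(\<exists>N' F'. skeleton E V ?K (boundary E ?K) N' F') \<and> card (boundary E ?K) \<le> h"
      proof
        assume Y: "boundary E ?K \<inter> (Y - S) = {}"
        have "card (boundary E ?K) \<le> h"
          using card_past_separator[OF finX finS YZ(1) XC _ bd Y] cardS YZ(4) h by simp
        moreover have "\<exists>N' F'. skeleton E V ?K (boundary E ?K) N' F'"
          by (rule skeleton_past_separator[OF sk E C(2) V C(1) X YZ(1-3) _ _ _ ne c refl Y])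
            (use S least in auto)
        ultimately show ?thesis by blast
      next
        assume Z: "boundary E ?K \<inter> (Z - S) = {}"
        have "card (boundary E ?K) \<le> h"
          using card_past_separator[OF finX finS YZ(2) XC _ bd Z] cardS YZ(5) h by simp
        moreover have "Z \<inter> Y = {}" using YZ(3) by blast
        then have "\<exists>N' F'. skeleton E V ?K (boundary E ?K) N' F'"
          by (rule skeleton_past_separator[OF sk E C(2) V C(1) X YZ(2,1) _ _ _ _ ne c refl Z])
            (use S least in \<open>auto simp: comm separates_commute[of _ _ _ Z Y]\<close>)
        ultimately show ?thesis by blast
      qed
      then show "decomposable E (h + n - 1) (component E (C - (S \<inter> C)) c)
          (boundary E (component E (C - (S \<inter> C)) c))"
        unfolding eqC using step[OF c ne] by blast
    qed blast
  qed
qed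

text \<open>A skeleton needs an attachment vertex, so the recursion cannot start at a whole
  component. Below an empty root bag each component gets a bag \<open>{x}\<close>, and every part of
  the component minus \<open>x\<close> has attachment set \<open>{x}\<close>.\<close>

lemma treewidth_le_if_separable:
  fixes G :: "'a pair_pre_digraph"
  assumes G: "pair_graph G" and n: "n > 0" and h: "h > 0"
    and sep: "\<And>C X N F. \<lbrakk>skeleton (parcs G) (pverts G) C X N F; conn (parcs G) C; C \<subseteq> pverts G;
        X = boundary (parcs G) C; card X = h\<rbrakk> \<Longrightarrow>
      \<exists>Y Z S. Y \<subseteq> X \<and> Z \<subseteq> X \<and> Y \<inter> Z = {} \<and> card Y = n \<and> card Z = n \<and> S \<subseteq> C \<union> Y \<union> Z \<and>
        separates (touching C (parcs G)) (C \<union> Y \<union> Z) S Y Z \<and> card S < n"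
  shows "treewidth G \<le> int (h + n - 1) - 1"
proof -
  interpret G: pair_graph G by (rule G)
  let ?E = "parcs G" and ?V = "pverts G" and ?w = "h + n - 1"
  have E: "sym ?E" using G.pair_sym_arcs by (simp add: symmetric_def)
  have V: "finite ?V" by (rule G.pair_finite_verts)
  have bdV: "boundary ?E ?V \<subseteq> {}" by (auto simp: boundary_def dest: G.in_arcsD2)
  have "decomposable ?E ?w ?V {}"
  proof (rule decomposable_glue[OF E V _ _ bdV, where S = "{}"])
    fix x assume x: "x \<in> ?V - {}"
    let ?K = "component ?E (?V - {}) x"
    have K: "?K \<subseteq> ?V" "conn ?E ?K" "x \<in> ?K"
      using component_subset[of ?E "?V - {}" x] conn_component[OF x] component_self[OF x] by auto
    have bdK: "boundary ?E ?K = {}" using boundary_component[OF E bdV x] by blast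
    have "decomposable ?E ?w ?K {}"
    proof (rule decomposable_glue[OF E _ _ _ _ _, where S = "{x}"])
      fix c assume c: "c \<in> ?K - {x}"
      let ?L = "component ?E (?K - {x}) c"
      have L: "?L \<subseteq> ?K - {x}" "conn ?E ?L" "?L \<noteq> {}"
        using component_subset[of ?E "?K - {x}" c] conn_component[OF c] component_self[OF c, of ?E] by auto
      have "?L \<inter> ?K \<noteq> {}" "\<not> ?K \<subseteq> ?L" using L K(3) by blast+
      then obtain a b where ab: "a \<in> ?L" "b \<in> ?K" "b \<notin> ?L" "(a, b) \<in> ?E"
        by (rule conn_crossing[OF K(2)])
      then have "b = x" using component_step[OF E c ab(1) _ ab(4)] by blast
      then have "x \<in> boundary ?E ?L" using ab by (auto simp: boundary_def)
      moreover have "boundary ?E ?L \<subseteq> {} \<union> ({x} \<inter> ?K)"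
        by (rule boundary_component[OF E eq_refl[OF bdK] c])
      ultimately have bd: "boundary ?E ?L = {x}" by blast
      \<comment> \<open>A single node without arcs, whose degree 0 meets all degree
        conditions.\<close>
      have sk: "skeleton ?E ?V ?L {x} {{x}} {}"
        unfolding skeleton_def using L K conn_singleton[of ?E x] conn_singleton[of "{}" "{x}"]
        by (auto simp: sym_def)
      show "decomposable ?E ?w ?L (boundary ?E ?L)"
        unfolding bd by (rule decomposable_if_separable[OF E V n _ sk L(2)], rule sep, assumption+)
          (use L K bd h in auto)
    qed (use finite_subset[OF K(1) V] K(3) bdK h n in auto)
    then show "decomposable ?E ?w ?K (boundary ?E ?K)" using bdK by simp
  qed auto
  then obtain bs where bs: "rip bs" "\<Union>(set bs) = ?V" "\<forall>b\<in>set bs. card b \<le> ?w"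
    "\<forall>u v. (u, v) \<in> ?E \<longrightarrow> u \<in> ?V \<longrightarrow> v \<in> ?V \<longrightarrow> (\<exists>b\<in>set bs. u \<in> b \<and> v \<in> b)"
    unfolding decomposable_def by auto
  show ?thesis
  proof (rule treewidth_le_rip[OF G bs(1,2)])
    fix u v assume uv: "(u, v) \<in> ?E"
    then show "\<exists>b\<in>set bs. u \<in> b \<and> v \<in> b"
      using bs(4) G.in_arcsD1[OF uv] G.in_arcsD2[OF uv] by blast
  qed (use bs(3) in blast)
qed

section \<open>The bound\<close>

text \<open>The splitting is applied to the skeleton, where the degree bound holds; the union of the
  nodes of a piece is connected in \<open>G\<close> and avoids \<open>C\<close>. The size of
  \<open>X\<close> is what \<open>2 * a\<close> pieces require. If no separator is small enough,
  Menger's theorem gives the links from which \<open>minor_of_linkage\<close> builds the excluded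
  minor.\<close>

lemma separable_if_no_minor:
  fixes G :: "'a pair_pre_digraph"
  assumes G: "pair_graph G" and "r > 0" "m > 0" "a > 0"
    and no: "\<not> minor_of (disjoint_copies k (complete_bipartite 2 r)) G"
    and count: "\<And>j. j < k \<Longrightarrow> 2 * j * m + (a - j)\<^sup>2 * (r - 1) < a * m"
    and sk: "skeleton (parcs G) (pverts G) C X N F" and C: "C \<subseteq> pverts G"
    and X: "card X = (2 * a - 1) * (2 * m - 1) + m"
  shows "\<exists>Y Z S. Y \<subseteq> X \<and> Z \<subseteq> X \<and> Y \<inter> Z = {} \<and> card Y = a * m \<and> card Z = a * m \<and> S \<subseteq> C \<union> Y \<union> Z \<and>
        separates (touching C (parcs G)) (C \<union> Y \<union> Z) S Y Z \<and> card S < a * m"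
proof -
  interpret G: pair_graph G by (rule G)
  let ?E = "parcs G" and ?V = "pverts G"
  have E: "sym ?E" using G.pair_sym_arcs by (simp add: symmetric_def)
  have V: "finite ?V" by (rule G.pair_finite_verts)
  note sk' = skeletonD[OF sk]
  have XC: "X \<inter> C = {}" using sk'(5,9) by blast
  have XV: "X \<subseteq> ?V" using sk'(5,8) by blast
  have finX: "finite X" using XV V finite_subset by blast
  \<comment> \<open>The marks for the splitting. A node carries at most one attachment vertex, so
    there are at least \<open>card X\<close> marks, and marks in a piece can be traded back for
    vertices of \<open>X\<close>.\<close>
  let ?W = "{n \<in> N. n \<inter> X \<noteq> {}}"
  have "\<forall>x\<in>X. \<exists>n. n \<in> N \<and> x \<in> n" using sk'(5) by blast
  from bchoice[OF this] obtain nd where nd: "\<And>x. x \<in> X \<Longrightarrow> nd x \<in> N" "\<And>x. x \<in> X \<Longrightarrow> x \<in> nd x" by blast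
  have nd_inj: "inj_on nd X"
  proof (rule inj_onI)
    fix x y assume xy: "x \<in> X" "y \<in> X" "nd x = nd y"
    show "x = y" using sk'(12)[OF nd(1)[OF xy(1)] nd(2)[OF xy(1)] xy(1) _ xy(2)] nd(2)[OF xy(2)] xy(3) by simp
  qed
  have nd_un: "nd x = n" if "n \<in> N" "x \<in> n" "x \<in> X" for n x
    using disjointD[OF sk'(4) nd(1)[OF that(3)] that(1)] nd(2)[OF that(3)] that(2) by blast
  have "card X \<le> card (N \<inter> ?W)"
    by (rule card_inj_on_le[OF nd_inj]) (use nd sk'(2) in auto)
  then have "(2 * a - 1) * (2 * m - 1) + m \<le> card (N \<inter> ?W)" using X by simp
  moreover have "card (F `` {n} \<inter> N) \<le> 3" if "n \<in> N" for n
  proof -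
    have "F `` {n} \<inter> N = F `` {n}" using sk'(6) by blast
    then show ?thesis using sk'(10)[OF that] by simp
  qed
  ultimately obtain \<T> where T: "\<And>i. i \<le> 2 * a - 1 \<Longrightarrow> \<T> i \<subseteq> N \<and> conn F (\<T> i) \<and> m \<le> card (\<T> i \<inter> ?W)"
    "disjoint_family_on \<T> {..2 * a - 1}"
    using conn_split[OF sk'(1-3) _ assms(3), of "2 * a - 1" ?W] by blast
  have le: "i \<le> 2 * a - 1" if "i < 2 * a" for i using that by simp
  define T where "T i = \<Union>(\<T> i)" for i
  have T_V: "T i \<subseteq> ?V" "T i \<inter> C = {}" if "i < 2 * a" for i
    using T(1)[OF le[OF that]] sk'(8,9) unfolding T_def by blast+
  have T_conn: "conn ?E (T i)" if "i < 2 * a" for i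
  proof -
    have "conn ?E (\<Union>n\<in>\<T> i. n)"
      by (rule conn_UN[OF E, of F]) (use T(1)[OF le[OF that]] sk'(7,13) in blast)+
    then show ?thesis by (simp add: T_def)
  qed
  have T_disj: "disjoint_family_on T {..<2 * a}"
    unfolding disjoint_family_on_def
  proof (intro ballI impI)
    fix i j assume ij: "i \<in> {..<2 * a}" "j \<in> {..<2 * a}" "i \<noteq> j"
    have "\<T> i \<inter> \<T> j = {}" using T(2) ij by (auto simp: disjoint_family_on_def)
    moreover have "\<T> i \<subseteq> N" "\<T> j \<subseteq> N" using T(1) le ij by auto
    ultimately have "p \<inter> q = {}" if "p \<in> \<T> i" "q \<in> \<T> j" for p q
      using that disjointD[OF sk'(4), of p q] by blast
    then show "T i \<inter> T j = {}" unfolding T_def by blast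
  qed
  have "\<exists>W. W \<subseteq> X \<inter> T i \<and> card W = m" if i: "i < 2 * a" for i
  proof -
    have "\<T> i \<inter> ?W \<subseteq> nd ` (X \<inter> T i)"
    proof
      fix n assume n: "n \<in> \<T> i \<inter> ?W"
      then obtain x where x: "x \<in> n" "x \<in> X" by blast
      then have "nd x = n" using nd_un n by blast
      moreover have "x \<in> T i" using n x unfolding T_def by blast
      ultimately show "n \<in> nd ` (X \<inter> T i)" using x by blast
    qed
    then have "card (\<T> i \<inter> ?W) \<le> card (X \<inter> T i)"
      using finX by (meson card_image_le card_mono finite_Int finite_imageI le_trans)
    then have "m \<le> card (X \<inter> T i)" using T(1)[OF le[OF i]] by linarith
    then show ?thesis using obtain_subset_with_card_n by metis
  qed
  then have "\<forall>i\<in>{..<2 * a}. \<exists>W. W \<subseteq> X \<inter> T i \<and> card W = m" by blast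
  from bchoice[OF this] obtain W
    where W: "\<And>i. i < 2 * a \<Longrightarrow> W i \<subseteq> X \<inter> T i" "\<And>i. i < 2 * a \<Longrightarrow> card (W i) = m" by blast
  define Y where "Y = (\<Union>i<a. W i)"
  define Z where "Z = (\<Union>i<a. W (a + i))"
  have Wdisj: "W i \<inter> W j = {}" if "i < 2 * a" "j < 2 * a" "i \<noteq> j" for i j
    using T_disj W(1)[OF that(1)] W(1)[OF that(2)] that by (fastforce simp: disjoint_family_on_def)
  have finW: "finite (W i)" if "i < 2 * a" for i
    using W(1)[OF that] finX by (meson finite_Int finite_subset)
  have "W i \<subseteq> X" "W (a + i) \<subseteq> X" if "i < a" for i
    using W(1)[of i] W(1)[of "a + i"] that by simp_all
  then have YX: "Y \<subseteq> X" "Z \<subseteq> X" unfolding Y_def Z_def by blast+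
  have "W i \<inter> W (a + j) = {}" if "i < a" "j < a" for i j
    using Wdisj[of i "a + j"] that by simp
  then have YZ: "Y \<inter> Z = {}" unfolding Y_def Z_def by blast
  have "card Y = (\<Sum>i<a. card (W i))" unfolding Y_def
    by (rule card_UN_disjoint) (use finW Wdisj in auto)
  then have cY: "card Y = a * m" using W(2) by simp
  have "card Z = (\<Sum>i<a. card (W (a + i)))" unfolding Z_def
    by (rule card_UN_disjoint) (use finW Wdisj in auto)
  then have cZ: "card Z = a * m" using W(2) by simp
  have "\<exists>S\<subseteq>C \<union> Y \<union> Z. separates (touching C ?E) (C \<union> Y \<union> Z) S Y Z \<and> card S < a * m"
  proof (rule ccontr)
    assume none: "\<not> ?thesis"
    have "finite (C \<union> Y \<union> Z)" using C V YX finX by (meson finite_UnI finite_subset)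
    then have "\<exists>\<P>. linkage (touching C ?E) (C \<union> Y \<union> Z) Y Z \<P> \<and> card \<P> = a * m"
      by (rule menger[OF sym_touching[OF E]]) (use none in \<open>auto simp: not_less\<close>)
    then obtain \<P> where L: "linkage (touching C ?E) (C \<union> Y \<union> Z) Y Z \<P>" "card \<P> = a * m" by blast
    have WT: "W i \<subseteq> T i" if "i < 2 * a" for i using W(1)[OF that] by blast
    have "minor_of (disjoint_copies k (complete_bipartite 2 r)) G"
      by (rule minor_of_linkage[OF G assms(2) C T_V(1) T_conn T_V(2) T_disj WT W(2) Y_def Z_def L count])
    then show False using no by simp
  qed
  then show ?thesis using YX YZ cY cZ by blast
qed

text \<open>
  The coefficient of \<open>r - 1\<close> in the difference of the two sides is
  \<open>3k\<^sup>2 - 2jk - j\<^sup>2 = (3k + j)(k - j) > 0\<close>.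
\<close>

lemma packing_count:
  fixes j k r :: nat
  assumes "j < k"
  shows "2 * j * (4 * k * (r - 1) + 1) + (3 * k - j)\<^sup>2 * (r - 1) < 3 * k * (4 * k * (r - 1) + 1)"
proof -
  obtain d where k: "k = j + d" "d > 0" using assms less_imp_add_positive by blast
  define s where "s = r - 1"
  have "3 * k - j = 2 * j + 3 * d" using k by simp
  then have "3 * k * (4 * k * s + 1)
      = 2 * j * (4 * k * s + 1) + (3 * k - j)\<^sup>2 * s + (j + 3 * d) + (4 * j * d + 3 * d * d) * s"
    unfolding k by (simp add: power2_eq_square algebra_simps)
  then show ?thesis using k(2) by (simp add: s_def)
qed

lemma width_bound:
  fixes k r :: nat
  assumes "k > 0" "r > 0" "m = 4 * k * (r - 1) + 1" "a = 3 * k"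
  shows "int ((2 * a - 1) * (2 * m - 1) + m + a * m - 1) - 1
    < 20 * (int k)\<^sup>2 * (int r)\<^sup>2 - 8 * (int k)\<^sup>2 * int r + 2 * int r - 1"
proof -
  obtain s where r: "r = Suc s" using assms(2) by (cases r) auto
  have pos: "1 \<le> 2 * a" "1 \<le> 2 * m" "1 \<le> (2 * a - 1) * (2 * m - 1) + m + a * m" using assms by auto
  define K S where "K = int k" and "S = int s"
  have KS: "K \<ge> 1" "S \<ge> 0" using assms(1) by (auto simp: K_def S_def)
  have m: "int m = 4 * K * S + 1" "int a = 3 * K" using assms r by (simp_all add: K_def S_def)
  have "int ((2 * a - 1) * (2 * m - 1) + m + a * m - 1) - 1
      = (2 * int a - 1) * (2 * int m - 1) + int m + int a * int m - 2"
    using pos by (simp add: of_nat_diff)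
  also have "\<dots> = 60 * K * K * S + 9 * K - 4 * K * S - 2"
    unfolding m by (simp add: algebra_simps)
  also have "\<dots> < 20 * K * K * (S + 1) * (S + 1) - 8 * K * K * (S + 1) + 2 * (S + 1) - 1"
  proof -
    have "20 * K * K * (S + 1) * (S + 1) - 8 * K * K * (S + 1) + 2 * (S + 1) - 1
        - (60 * K * K * S + 9 * K - 4 * K * S - 2)
        = K * K * (20 * S * S - 28 * S + 12) - 9 * K + 4 * K * S + 2 * S + 3"
      by (simp add: algebra_simps)
    \<comment> \<open>For \<open>S = 0\<close> and \<open>S = 1\<close> the coefficient of
      \<open>K * K\<close> is 12 and 4, and \<open>2 * K \<le> K * K + 1\<close> absorbs the linear
      term. From \<open>S = 2\<close> on it is at least 9, and \<open>9 * K * K\<close> covers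
      \<open>9 * K\<close>.\<close>
    moreover have "K * K * (20 * S * S - 28 * S + 12) - 9 * K + 4 * K * S + 2 * S + 3 > 0"
    proof (cases "S = 0 \<or> S = 1")
      case True
      have "0 \<le> (K - 1) * (K - 1)" by simp
      then have "2 * K \<le> K * K + 1" by (simp add: algebra_simps)
      then show ?thesis using True KS by auto
    next
      case False
      then have S: "S \<ge> 2" using KS by simp
      have "20 * S * S - 28 * S + 12 = 20 * ((S - 1) * (S - 2)) + 32 * S - 28" by (simp add: algebra_simps)
      moreover have "(S - 1) * (S - 2) \<ge> 0" using S by simp
      ultimately have "20 * S * S - 28 * S + 12 \<ge> 9" using S by linarith
      then have "K * K * (20 * S * S - 28 * S + 12) \<ge> K * K * 9"
        by (rule mult_left_mono) simp
      moreover have "K * K \<ge> K" using KS(1) by simp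
      moreover have "4 * K * S \<ge> 0" using KS by simp
      ultimately show ?thesis using S by linarith
    qed
    ultimately show ?thesis by linarith
  qed
  finally show ?thesis using r by (simp add: K_def S_def power2_eq_square algebra_simps)
qed

theorem theorem4:
  fixes G :: "'a pair_pre_digraph" and r k :: nat
  assumes "r > 0" and "k > 0"
    and "pair_graph G"
    and "\<not> minor_of (disjoint_copies k (complete_bipartite 2 r)) G"
  shows "treewidth G < 20 * (int k)\<^sup>2 * (int r)\<^sup>2 - 8 * (int k)\<^sup>2 * int r + 2 * int r - 1"
proof -
  define m where "m = 4 * k * (r - 1) + 1"
  define a where "a = 3 * k"
  let ?h = "(2 * a - 1) * (2 * m - 1) + m"
  have pos: "m > 0" "a > 0" "a * m > 0" "?h > 0" using assms(2) by (simp_all add: m_def a_def)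
  have count: "2 * j * m + (a - j)\<^sup>2 * (r - 1) < a * m" if "j < k" for j
    using packing_count[OF that] by (simp add: m_def a_def)
  have "treewidth G \<le> int (?h + a * m - 1) - 1"
    by (rule treewidth_le_if_separable[OF assms(3) pos(3,4)])
      (rule separable_if_no_minor[OF assms(3,1) pos(1,2) assms(4) count])
  also have "\<dots> < 20 * (int k)\<^sup>2 * (int r)\<^sup>2 - 8 * (int k)\<^sup>2 * int r + 2 * int r - 1"
    by (rule width_bound[OF assms(2,1) m_def a_def])
  finally show ?thesis .
qed

end
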